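(* Let $H$ be a realizable 3-uniform hypergraph. Then the number $|\mathscr{R}(H)|$ of realizations of $H$ is $$|\mathscr{R}(H)|=2^{|\mathscr{D}_\triangle(H)|}\times\prod_{X\in\mathscr{D}_\circ(H)}|\Pi(H[X])|!\,.$$
   Context: All structures are finite. A 3-uniform hypergraph $H$ consists of a vertex set $V(H)$ and an edge set $E(H)\subseteq\binom{V(H)}{3}$; it is empty if $E(H)=\emptyset$. For $W\subseteq V(H)$, $H[W]$ is the hypergraph with vertex set $W$ and edge set $\{e\in E(H):e\subseteq W\}$. A 3-cycle is a tournament on three vertices isomorphic to $(\{0,1,2\},\{01,12,20\})$. The $C_3$-structure $C_3(T)$ of a tournament $T$ is the 3-uniform hypergraph on $V(T)$ whose edges are the 3-element subsets $X$ of $V(T)$ such that $T[X]$ is a 3-cycle. A tournament $T$ with $V(T)=V(H)$ is a realization of $H$ if $H=C_3(T)$; $\mathscr{R}(H)$ is the set of realizations of $H$, and $H$ is realizable if $\mathscr{R}(H)\neq\emptyset$. A subset $M$ of $V(H)$ is a module of $H$ if for each $e\in E(H)$ such that $e\cap M\neq\emptyset$ and $e\setminus M\neq\emptyset$, there exists $m\in M$ such that $e\cap M=\{m\}$ and for every $n\in M$, $(e\setminus\{m\})\cup\{n\}\in E(H)$. The sets $\emptyset$, $V(H)$ and $\{v\}$ ($v\in V(H)$) are modules, called trivial. $H$ is prime if $|V(H)|\geq 3$ and all its modules are trivial. A module $M$ of $H$ is strong if for every module $N$ of $H$ with $M\cap N\neq\emptyset$, we have $M\subseteq N$ or $N\subseteq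 M$. When $|V(H)|\geq 2$, $\Pi(H)$ denotes the set of the strong modules of $H$ distinct from $V(H)$ that are maximal under inclusion among those; it is a partition of $V(H)$. For a partition $P$ of $V(H)$ into modules of $H$, the quotient $H/P$ is the hypergraph with vertex set $P$ such that $\mathcal{E}\subseteq P$ is an edge of $H/P$ iff $|\mathcal{E}|\geq 2$ and there exists $e\in E(H)$ with $\mathcal{E}=\{X\in P:X\cap e\neq\emptyset\}$. $\mathscr{D}_{\geq 2}(H)$ is the set of strong modules $X$ of $H$ with $|X|\geq 2$. $\mathscr{D}_\triangle(H)$ is the set of $X\in\mathscr{D}_{\geq 2}(H)$ such that $H[X]/\Pi(H[X])$ is prime, and $\mathscr{D}_\circ(H)$ is the set of $X\in\mathscr{D}_{\geq 2}(H)$ such that $H[X]/\Pi(H[X])$ is empty. *)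

theory Defs
  imports "Graph_Theory.Graph_Theory"
begin

record 'a hypergraph =
  hverts :: "'a set"
  hedges :: "'a set set"

definition three_uniform :: "'a hypergraph \<Rightarrow> bool" where
  "three_uniform H \<longleftrightarrow>
     finite (hverts H) \<and> hedges H \<subseteq> {e. e \<subseteq> hverts H \<and> card e = 3}"

definition empty_hypergraph :: "'a hypergraph \<Rightarrow> bool" where
  "empty_hypergraph H \<longleftrightarrow> hedges H = {}"

definition induced_hypergraph :: "'a hypergraph \<Rightarrow> 'a set \<Rightarrow> 'a hypergraph" where
  "induced_hypergraph H W = \<lparr>hverts = W, hedges = {e \<in> hedges H. e \<subseteq> W}\<rparr>"

definition hmodule :: "'a hypergraph \<Rightarrow> 'a set \<Rightarrow> bool" where
  "hmodule H M \<longleftrightarrow>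
     M \<subseteq> hverts H \<and>
     (\<forall>e \<in> hedges H. e \<inter> M \<noteq> {} \<and> e - M \<noteq> {} \<longrightarrow>
        (\<exists>m \<in> M. e \<inter> M = {m} \<and> (\<forall>n \<in> M. (e - {m}) \<union> {n} \<in> hedges H)))"

definition trivial_hmodule :: "'a hypergraph \<Rightarrow> 'a set \<Rightarrow> bool" where
  "trivial_hmodule H M \<longleftrightarrow> M = {} \<or> M = hverts H \<or> (\<exists>v \<in> hverts H. M = {v})"

definition prime_hypergraph :: "'a hypergraph \<Rightarrow> bool" where
  "prime_hypergraph H \<longleftrightarrow>
     card (hverts H) \<ge> 3 \<and> (\<forall>M. hmodule H M \<longrightarrow> trivial_hmodule H M)"

definition strong_hmodule :: "'a hypergraph \<Rightarrow> 'a set \<Rightarrow> bool" where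
  "strong_hmodule H M \<longleftrightarrow>
     hmodule H M \<and> (\<forall>N. hmodule H N \<and> M \<inter> N \<noteq> {} \<longrightarrow> M \<subseteq> N \<or> N \<subseteq> M)"

text \<open>
  Only meaningful for hypergraphs with at least two vertices, where it is a
  partition of the vertex set.
\<close>

definition max_strong_hmodules :: "'a hypergraph \<Rightarrow> 'a set set" where
  "max_strong_hmodules H =
     {M. strong_hmodule H M \<and> M \<noteq> hverts H \<and>
         (\<forall>N. strong_hmodule H N \<and> N \<noteq> hverts H \<and> M \<subseteq> N \<longrightarrow> N = M)}"

text \<open>Only meaningful when \<open>P\<close> is a partition of the vertex set into modules.\<close>

definition quotient_hypergraph :: "'a hypergraph \<Rightarrow> 'a set set \<Rightarrow> 'a set hypergraph" where
  "quotient_hypergraph H P =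
     \<lparr>hverts = P,
      hedges = {E. E \<subseteq> P \<and> card E \<ge> 2 \<and>
                   (\<exists>e \<in> hedges H. E = {X \<in> P. X \<inter> e \<noteq> {}})}\<rparr>"

definition strong_hmodules_ge2 :: "'a hypergraph \<Rightarrow> 'a set set" where
  "strong_hmodules_ge2 H = {X. strong_hmodule H X \<and> card X \<ge> 2}"

definition strong_hmodules_prime :: "'a hypergraph \<Rightarrow> 'a set set" where
  "strong_hmodules_prime H =
     {X \<in> strong_hmodules_ge2 H.
        prime_hypergraph (quotient_hypergraph (induced_hypergraph H X)
          (max_strong_hmodules (induced_hypergraph H X)))}"

definition strong_hmodules_empty :: "'a hypergraph \<Rightarrow> 'a set set" where
  "strong_hmodules_empty H =
     {X \<in> strong_hmodules_ge2 H.
        empty_hypergraph (quotient_hypergraph (induced_hypergraph H X)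
          (max_strong_hmodules (induced_hypergraph H X)))}"

definition tournament :: "'a pair_pre_digraph \<Rightarrow> bool" where
  "tournament T \<longleftrightarrow>
     pair_digraph T \<and>
     (\<forall>u \<in> pverts T. \<forall>v \<in> pverts T.
        u \<noteq> v \<longrightarrow> ((u, v) \<in> parcs T \<longleftrightarrow> (v, u) \<notin> parcs T))"

definition three_cycle :: "nat pair_pre_digraph" where
  "three_cycle = \<lparr>pverts = {0, 1, 2}, parcs = {(0, 1), (1, 2), (2, 0)}\<rparr>"

definition C3_structure :: "'a pair_pre_digraph \<Rightarrow> 'a hypergraph" where
  "C3_structure T =
     \<lparr>hverts = pverts T,
      hedges = {X. X \<subseteq> pverts T \<and> card X = 3 \<and>
                   digraph_iso (with_proj T \<restriction> X) (with_proj three_cycle)}\<rparr>"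

definition realizations :: "'a hypergraph \<Rightarrow> 'a pair_pre_digraph set" where
  "realizations H = {T. tournament T \<and> pverts T = hverts H \<and> H = C3_structure T}"

definition realizable :: "'a hypergraph \<Rightarrow> bool" where
  "realizable H \<longleftrightarrow> realizations H \<noteq> {}"

end

theory Submission
  imports Defs "HOL-Library.FuncSet"
begin

text \<open>
  Induction along the modular decomposition: the realizations of \<open>H\<close> are the independent
  combinations of realizations of the \<open>H[B]\<close>, for \<open>B\<close> in \<open>\<Pi>(H)\<close>, with an orientation of the
  pairs that cross \<open>\<Pi>(H)\<close>.

  If \<open>H\<close> is disconnected, \<open>\<Pi>(H)\<close> consists of its components, which are modules of every
  realization, and the crossing pairs are oriented by an arbitrary linear order of the
  components. If \<open>H\<close> is connected, \<open>\<Pi>(H)\<close> consists of the maximal proper modules of any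
  realization \<open>T\<close>. For another realization \<open>T'\<close>, the arcs of \<open>T\<close> kept by \<open>T'\<close> and those
  reversed by \<open>T'\<close> both form quasi-transitive digraphs \<open>A\<close> and \<open>B\<close>. A 3-cycle inside no
  proper module is monochromatic, say in \<open>A\<close>; its strong component in \<open>A\<close> is a module of \<open>T\<close>,
  so \<open>A\<close> is strongly connected, and then any two vertices joined by \<open>B\<close> lie in a common
  proper module. Hence \<open>T'\<close> agrees with \<open>T\<close> or with its converse on all crossing pairs.
\<close>

section \<open>Tournaments as relations\<close>

text \<open>The choices are independent because a 3-cycle contained in no block meets each block at
  most once, the blocks being modules of the tournament; so all its arcs cross, while a 3-cycle
  inside a block does not see the crossing arcs. The main obstacle is that a module of
  \<open>H\<close> need not be a module of a realization: in an edgeless hypergraph every vertex set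
  is a module, in a transitive tournament only the intervals are. In the connected case the gap is
  bridged by enlarging a proper module of \<open>H\<close> to a proper module of \<open>T\<close>,
  which suffices to identify the maximal proper modules of \<open>T\<close> with the blocks of
  \<open>H\<close>. The two colour classes are quasi-transitive because two consecutive arcs of a
  triple, together with the knowledge whether it is an edge, determine its third arc. The factor 2
  counts \<open>T\<close> and its converse, which differ on crossing pairs since some edge crosses;
  the factorial counts the linear orders of the components, that is, the tournaments without
  3-cycles on them.\<close>

definition tour :: "'a set \<Rightarrow> 'a rel \<Rightarrow> bool" where
  "tour V R \<longleftrightarrow> R \<subseteq> V \<times> V \<and> irrefl R \<and>
     (\<forall>x\<in>V. \<forall>y\<in>V. x \<noteq> y \<longrightarrow> ((x, y) \<in> R \<longleftrightarrow> (y, x) \<notin> R))"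

definition cyc :: "'a rel \<Rightarrow> 'a set set" where
  "cyc R = {{a, b, c} | a b c. (a, b) \<in> R \<and> (b, c) \<in> R \<and> (c, a) \<in> R}"

text \<open>Vertices and edges are separate arguments, so that realizations of an induced hypergraph
  are \<open>realizing B {e \<in> F. e \<subseteq> B}\<close> and the edgeless case can be used with
  components as vertices.\<close>

definition realizing :: "'a set \<Rightarrow> 'a set set \<Rightarrow> 'a rel set" where
  "realizing V F = {R. tour V R \<and> cyc R = F}"

lemma tour_asym: "tour V R \<Longrightarrow> (x, y) \<in> R \<Longrightarrow> (y, x) \<notin> R"
  by (cases "x = y") (auto simp: tour_def irrefl_def)

lemma tour_irrefl: "tour V R \<Longrightarrow> (x, x) \<notin> R"
  unfolding tour_def irrefl_def by blast

lemma tour_total: "tour V R \<Longrightarrow> x \<in> V \<Longrightarrow> y \<in> V \<Longrightarrow> x \<noteq> y \<Longrightarrow> (x, y) \<notin> R \<Longrightarrow> (y, x) \<in> R"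
  unfolding tour_def by blast

lemma tour_field: "tour V R \<Longrightarrow> (x, y) \<in> R \<Longrightarrow> x \<in> V \<and> y \<in> V"
  unfolding tour_def by blast

lemma tourI:
  assumes "R \<subseteq> V \<times> V" "\<And>x y. (x, y) \<in> R \<Longrightarrow> (y, x) \<notin> R"
    "\<And>x y. x \<in> V \<Longrightarrow> y \<in> V \<Longrightarrow> x \<noteq> y \<Longrightarrow> (x, y) \<in> R \<or> (y, x) \<in> R"
  shows "tour V R"
  using assms unfolding tour_def irrefl_def by blast

lemma cycI: "(a, b) \<in> R \<Longrightarrow> (b, c) \<in> R \<Longrightarrow> (c, a) \<in> R \<Longrightarrow> {a, b, c} \<in> cyc R"
  unfolding cyc_def by blast

lemma cycE:
  assumes "e \<in> cyc R"
  obtains a b c where "e = {a, b, c}" "(a, b) \<in> R" "(b, c) \<in> R" "(c, a) \<in> R"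
  using assms unfolding cyc_def by blast

text \<open>A set of three vertices forgets the starting point and the direction of a cycle; up to
  rotation two directed cycles remain.\<close>

lemma cyc_iff:
  assumes R: "tour V R"
  shows "{a, b, c} \<in> cyc R \<longleftrightarrow>
    (a, b) \<in> R \<and> (b, c) \<in> R \<and> (c, a) \<in> R \<or> (a, c) \<in> R \<and> (c, b) \<in> R \<and> (b, a) \<in> R"
proof
  assume "{a, b, c} \<in> cyc R"
  then obtain p q r where e: "{a, b, c} = {p, q, r}"
    and pqr: "(p, q) \<in> R" "(q, r) \<in> R" "(r, p) \<in> R" by (rule cycE)
  have n: "p \<noteq> q" "q \<noteq> r" "r \<noteq> p" using pqr tour_irrefl[OF R] by auto
  have "p \<in> {a, b, c}" "q \<in> {a, b, c}" "r \<in> {a, b, c}" by (auto simp: e)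
  then show "(a, b) \<in> R \<and> (b, c) \<in> R \<and> (c, a) \<in> R \<or> (a, c) \<in> R \<and> (c, b) \<in> R \<and> (b, a) \<in> R"
    using n pqr by auto
next
  assume "(a, b) \<in> R \<and> (b, c) \<in> R \<and> (c, a) \<in> R \<or> (a, c) \<in> R \<and> (c, b) \<in> R \<and> (b, a) \<in> R"
  then show "{a, b, c} \<in> cyc R"
    using cycI[of a b R c] cycI[of a c R b] by (auto simp: insert_commute)
qed

lemma cyc_card: "tour V R \<Longrightarrow> e \<in> cyc R \<Longrightarrow> card e = 3"
  by (erule cycE) (auto dest: tour_irrefl tour_asym simp: card_insert_if)

lemma cyc_sub: "tour V R \<Longrightarrow> e \<in> cyc R \<Longrightarrow> e \<subseteq> V"
  by (erule cycE) (auto dest: tour_field)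

section \<open>Isomorphism with the directed 3-cycle, expressed by arcs\<close>

lemma digraph_iso_three_cycle:
  assumes T: "tournament T" and X: "X \<subseteq> pverts T"
  shows "digraph_iso (with_proj T \<restriction> X) (with_proj three_cycle) \<longleftrightarrow> X \<in> cyc (parcs T)"
    (is "digraph_iso ?G _ \<longleftrightarrow> _")
proof
  assume "digraph_iso ?G (with_proj three_cycle)"
  then obtain h where h: "pre_digraph.digraph_isomorphism ?G h"
    and eq: "with_proj three_cycle = app_iso h ?G"
    unfolding digraph_iso_def by blast
  define f where "f = iso_verts h"
  have vs: "f ` X = {0, 1, 2}"
    using arg_cong[OF eq, of verts] by (simp add: f_def three_cycle_def)
  have inj: "inj_on f X" using h by (simp add: pre_digraph.digraph_isomorphism_def f_def)
  \<comment> \<open>Both digraphs store arcs as ordered pairs, so comparing the fields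
    \<open>tail\<close> and \<open>head\<close> fixes these components of \<open>h\<close>; its arc
    map is then \<open>f\<close> applied to both ends.\<close>
  have ht: "iso_tail h = fst" "iso_head h = snd"
    using arg_cong[OF eq, of tail] arg_cong[OF eq, of head] by simp_all
  have arc: "\<And>a. a \<in> parcs T \<Longrightarrow> fst a \<in> X \<Longrightarrow> snd a \<in> X \<Longrightarrow> iso_arcs h a = (f (fst a), f (snd a))"
    using h by (auto simp: pre_digraph.digraph_isomorphism_def f_def ht prod_eq_iff)
  have as: "{(0, 1), (1, 2), (2, 0)} = iso_arcs h ` {a \<in> parcs T. fst a \<in> X \<and> snd a \<in> X}"
    using arg_cong[OF eq, of arcs] by (simp add: three_cycle_def)
  obtain a b c where abc: "a \<in> X" "b \<in> X" "c \<in> X" "f a = 0" "f b = 1" "f c = 2"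
    using vs by (metis imageE insertI1 insertI2)
  have Xe: "X = {a, b, c}"
  proof
    show "X \<subseteq> {a, b, c}"
    proof
      fix x assume x: "x \<in> X"
      then have "f x \<in> {0, 1, 2}" using vs by blast
      then show "x \<in> {a, b, c}" using abc inj x unfolding inj_on_def by (metis insert_iff empty_iff)
    qed
  qed (use abc in auto)
  \<comment> \<open>An arc of the 3-cycle is the image of an arc of \<open>T\<close> inside
    \<open>X\<close> whose ends have the same \<open>f\<close>-values as \<open>u\<close> and
    \<open>v\<close>; injectivity identifies them.\<close>
  have *: "(u, v) \<in> parcs T" if "(f u, f v) \<in> {(0, 1), (1, 2), (2, 0)}" "u \<in> X" "v \<in> X" for u v
  proof -
    have "(f u, f v) \<in> iso_arcs h ` {a \<in> parcs T. fst a \<in> X \<and> snd a \<in> X}"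
      using that(1) unfolding as .
    then obtain p where "p \<in> {a \<in> parcs T. fst a \<in> X \<and> snd a \<in> X}" "(f u, f v) = iso_arcs h p"
      by (rule imageE)
    then have p: "p \<in> parcs T" "fst p \<in> X" "snd p \<in> X" "iso_arcs h p = (f u, f v)" by simp_all
    then have "f (fst p) = f u" "f (snd p) = f v" using arc[OF p(1-3)] by auto
    then have "fst p = u" "snd p = v" using inj that p unfolding inj_on_def by blast+
    with p(1) show ?thesis by auto
  qed
  show "X \<in> cyc (parcs T)"
    unfolding Xe by (rule cycI; rule *) (auto simp: abc)
next
  assume "X \<in> cyc (parcs T)"
  then obtain a b c where Xe: "X = {a, b, c}"
    and ar: "(a, b) \<in> parcs T" "(b, c) \<in> parcs T" "(c, a) \<in> parcs T" by (rule cycE)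
  interpret pair_digraph T using T by (simp add: tournament_def)
  have irr: "\<And>x. (x, x) \<notin> parcs T" using pair_no_loops by fastforce
  have n: "a \<noteq> b" "b \<noteq> c" "c \<noteq> a" using ar irr by auto
  have asy: "(b, a) \<notin> parcs T" "(c, b) \<notin> parcs T" "(a, c) \<notin> parcs T"
    using T ar n X unfolding tournament_def Xe by blast+
  define f where "f x = (if x = a then 0 else if x = b then 1 else 2 :: nat)" for x
  define h where "h = \<lparr>iso_verts = f, iso_arcs = (\<lambda>(x, y). (f x, f y)), iso_head = snd, iso_tail = fst\<rparr>"
  have arcs: "{e \<in> parcs T. fst e \<in> X \<and> snd e \<in> X} = {(a, b), (b, c), (c, a)}"
    unfolding Xe using ar asy irr by auto
  have "wf_digraph ?G" by unfold_locales auto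
  then have iso: "pre_digraph.digraph_isomorphism ?G h"
    unfolding pre_digraph.digraph_isomorphism_def
    by (auto simp: h_def arcs f_def n n[symmetric] inj_on_def Xe split: if_splits)
  have "f ` X = {0, 1, 2}"
    using n n[symmetric] unfolding Xe by (auto simp: f_def)
  moreover have "(\<lambda>(x, y). (f x, f y)) ` {e \<in> parcs T. fst e \<in> X \<and> snd e \<in> X} =
      {(0, 1), (1, 2), (2, 0)}"
    unfolding arcs using n n[symmetric] by (simp add: f_def)
  ultimately have "with_proj three_cycle = app_iso h ?G"
    by (simp add: app_iso_def h_def with_proj_def three_cycle_def)
  with iso show "digraph_iso ?G (with_proj three_cycle)"
    unfolding digraph_iso_def by blast
qed

lemma tournament_iff:
  "tournament T \<longleftrightarrow> finite (pverts T) \<and> tour (pverts T) (parcs T)"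
proof
  assume T: "tournament T"
  interpret pair_digraph T using T by (simp add: tournament_def)
  have "irrefl (parcs T)" using pair_no_loops by (fastforce simp: irrefl_def)
  moreover have "parcs T \<subseteq> pverts T \<times> pverts T"
    using arc_fst_in_verts arc_snd_in_verts by fastforce
  ultimately show "finite (pverts T) \<and> tour (pverts T) (parcs T)"
    using T pair_finite_verts unfolding tour_def tournament_def by blast
next
  assume *: "finite (pverts T) \<and> tour (pverts T) (parcs T)"
  then have "finite (parcs T)"
    using finite_subset[of "parcs T" "pverts T \<times> pverts T"] by (simp add: tour_def)
  moreover have "fst e \<in> pverts T \<and> snd e \<in> pverts T \<and> fst e \<noteq> snd e" if "e \<in> parcs T" for e
    using that * tour_field tour_irrefl by (cases e) fastforce
  ultimately have "pair_digraph T"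
    by (simp add: pair_digraph_def pair_fin_digraph_def pair_loopfree_digraph_def
        pair_wf_digraph_def pair_fin_digraph_axioms_def pair_loopfree_digraph_axioms_def *)
  with * show "tournament T" unfolding tour_def tournament_def by blast
qed

lemma C3_structure_eq:
  assumes "tournament T"
  shows "C3_structure T = \<lparr>hverts = pverts T, hedges = cyc (parcs T)\<rparr>"
  using assms digraph_iso_three_cycle[OF assms]
  by (auto simp: C3_structure_def tournament_iff dest: cyc_card cyc_sub)

text \<open>The vertex set of a realization is prescribed, so its arcs determine it.\<close>

lemma card_realizations:
  assumes "finite (hverts H)"
  shows "card (realizations H) = card (realizing (hverts H) (hedges H))"
proof -
  have "bij_betw parcs (realizations H) (realizing (hverts H) (hedges H))"
  proof (rule bij_betw_byWitness[where f' = "\<lambda>R. \<lparr>pverts = hverts H, parcs = R\<rparr>"])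
    show "parcs ` realizations H \<subseteq> realizing (hverts H) (hedges H)"
    proof
      fix R assume "R \<in> parcs ` realizations H"
      then obtain T where T: "R = parcs T" "tournament T" "pverts T = hverts H" "H = C3_structure T"
        by (auto simp: realizations_def)
      have "hedges H = cyc (parcs T)"
        using arg_cong[OF T(4), of hedges] C3_structure_eq[OF T(2)] by simp
      then show "R \<in> realizing (hverts H) (hedges H)"
        using T(1-3) by (simp add: realizing_def tournament_iff)
    qed
    show "(\<lambda>R. \<lparr>pverts = hverts H, parcs = R\<rparr>) ` realizing (hverts H) (hedges H) \<subseteq> realizations H"
    proof
      fix T assume "T \<in> (\<lambda>R. \<lparr>pverts = hverts H, parcs = R\<rparr>) ` realizing (hverts H) (hedges H)"
      then obtain R where T: "T = \<lparr>pverts = hverts H, parcs = R\<rparr>"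
        and R: "tour (hverts H) R" "cyc R = hedges H" by (auto simp: realizing_def)
      have t: "tournament T" using R assms by (simp add: T tournament_iff)
      show "T \<in> realizations H"
        using t R unfolding realizations_def by (simp add: C3_structure_eq[OF t]) (simp add: T)
    qed
  qed (auto simp: realizations_def)
  then show ?thesis by (rule bij_betw_same_card)
qed

section \<open>Quasi-transitive relations and two-coloured tournaments\<close>

definition tour_module :: "'a set \<Rightarrow> 'a rel \<Rightarrow> 'a set \<Rightarrow> bool" where
  "tour_module V R M \<longleftrightarrow> M \<subseteq> V \<and> (\<forall>v\<in>V - M. \<forall>x\<in>M. \<forall>y\<in>M. (v, x) \<in> R \<longleftrightarrow> (v, y) \<in> R)"

definition adj :: "'a rel \<Rightarrow> 'a \<Rightarrow> 'a \<Rightarrow> bool" where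
  "adj A x y \<longleftrightarrow> (x, y) \<in> A \<or> (y, x) \<in> A"

text \<open>The case \<open>x = z\<close> is included; for the asymmetric relations considered below
  its premise never holds.\<close>

definition quasi_transitive :: "'a rel \<Rightarrow> bool" where
  "quasi_transitive A \<longleftrightarrow> (\<forall>x y z. (x, y) \<in> A \<and> (y, z) \<in> A \<longrightarrow> adj A x z)"

lemma adj_sym: "adj A x y \<longleftrightarrow> adj A y x"
  unfolding adj_def by blast

lemma quasi_transitiveD: "quasi_transitive A \<Longrightarrow> (x, y) \<in> A \<Longrightarrow> (y, z) \<in> A \<Longrightarrow> adj A x z"
  unfolding quasi_transitive_def by blast

text \<open>Used for contradictions: if \<open>x\<close> reaches every vertex, a nonempty set of
  vertices closed under predecessors must contain \<open>x\<close>.\<close>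

lemma closed_pred_reach:
  assumes "(x, n) \<in> A\<^sup>*" "n \<in> S" "\<And>p q. (p, q) \<in> A \<Longrightarrow> q \<in> S \<Longrightarrow> p \<in> S"
  shows "x \<in> S"
  using assms(1,2) by (induction rule: converse_rtrancl_induct) (use assms(3) in blast)+

lemma tour_moduleI:
  assumes T: "tour V T" and M: "M \<subseteq> V"
    and u: "\<And>v. v \<in> V - M \<Longrightarrow> (\<forall>x\<in>M. (v, x) \<in> T) \<or> (\<forall>x\<in>M. (x, v) \<in> T)"
  shows "tour_module V T M"
  unfolding tour_module_def using M u tour_asym[OF T] by blast

lemma tour_moduleD:
  assumes "tour V T" "tour_module V T M" "v \<in> V" "v \<notin> M" "x \<in> M" "y \<in> M"
  shows "(v, x) \<in> T \<longleftrightarrow> (v, y) \<in> T" "(x, v) \<in> T \<longleftrightarrow> (y, v) \<in> T"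
proof -
  show 1: "(v, x) \<in> T \<longleftrightarrow> (v, y) \<in> T" using assms unfolding tour_module_def by blast
  have "x \<in> V" "y \<in> V" "v \<noteq> x" "v \<noteq> y" using assms unfolding tour_module_def by blast+
  then have "(x, v) \<in> T \<longleftrightarrow> (v, x) \<notin> T" "(y, v) \<in> T \<longleftrightarrow> (v, y) \<notin> T"
    using assms(1,3) unfolding tour_def by blast+
  with 1 show "(x, v) \<in> T \<longleftrightarrow> (y, v) \<in> T" by blast
qed

text \<open>The conditions are symmetric in \<open>A\<close> and \<open>B\<close>, so the locale can
  be instantiated with kept and reversed arcs in either role.\<close>

locale two_coloured =
  fixes V :: "'a set" and T A B :: "'a rel"
  assumes fin: "finite V" and T: "tour V T" and un: "T = A \<union> B" and dj: "A \<inter> B = {}"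
    and qA: "quasi_transitive A" and qB: "quasi_transitive B"
begin

lemma A_asym: "(x, y) \<in> A \<Longrightarrow> (y, x) \<notin> A" using tour_asym[OF T] un by blast
lemma B_asym: "(x, y) \<in> B \<Longrightarrow> (y, x) \<notin> B" using tour_asym[OF T] un by blast
lemma A_irrefl: "(x, x) \<notin> A" using A_asym by blast
lemma A_V: "(x, y) \<in> A \<Longrightarrow> x \<in> V \<and> y \<in> V" using tour_field[OF T] un by blast
lemma B_V: "(x, y) \<in> B \<Longrightarrow> x \<in> V \<and> y \<in> V" using tour_field[OF T] un by blast

lemma adj_AB: "adj A x y \<Longrightarrow> \<not> adj B x y"
  using dj tour_asym[OF T] un unfolding adj_def by blast

lemma not_adjA: "x \<in> V \<Longrightarrow> y \<in> V \<Longrightarrow> x \<noteq> y \<Longrightarrow> \<not> adj A x y \<Longrightarrow> adj B x y"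
  using tour_total[OF T] un unfolding adj_def by blast

lemma adjB_V: "adj B x y \<Longrightarrow> x \<in> V \<and> y \<in> V" using B_V unfolding adj_def by blast

text \<open>If a vertex outside \<open>S\<close> is \<open>A\<close>-adjacent to some vertex of
  \<open>S\<close>, quasi-transitivity carries that arc along \<open>A\<close>-paths, since an arc
  the other way would pull the vertex into \<open>S\<close>. If it is adjacent to none, it is joined
  to all of \<open>S\<close> by \<open>B\<close>.\<close>

lemma strong_component_tour_module:
  assumes s: "s \<in> V" and S: "S = {y. (s, y) \<in> A\<^sup>* \<and> (y, s) \<in> A\<^sup>*}"
  shows "tour_module V T S"
proof (rule tour_moduleI[OF T])
  show SV: "S \<subseteq> V"
  proof
    fix y assume "y \<in> S"
    then have "(s, y) \<in> A\<^sup>*" using S by blast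
    then show "y \<in> V" using s by (cases rule: rtranclE) (auto dest: A_V)
  qed
  have conn: "(x, y) \<in> A\<^sup>*" if "x \<in> S" "y \<in> S" for x y
    using that unfolding S by (metis (mono_tags) mem_Collect_eq rtrancl_trans)
  fix v assume v: "v \<in> V - S"
  have nS: "\<not> ((x, v) \<in> A\<^sup>* \<and> (v, y) \<in> A\<^sup>*)" if "x \<in> S" "y \<in> S" for x y
    using that v unfolding S by (metis (mono_tags, lifting) DiffD2 mem_Collect_eq rtrancl_trans)
  show "(\<forall>x\<in>S. (v, x) \<in> T) \<or> (\<forall>x\<in>S. (x, v) \<in> T)"
  proof (cases "\<exists>x\<in>S. adj A v x")
    case True
    then obtain x where x: "x \<in> S" "adj A v x" by blast
    show ?thesis
    proof (cases "(v, x) \<in> A")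
      case True
      have "(v, y) \<in> A" if "(x, y) \<in> A\<^sup>*" for y using that
      proof (induction rule: rtrancl_induct)
        case (step p q)
        have "q \<noteq> v" "(q, v) \<notin> A" using nS[OF x(1) x(1)] step True
          by (metis r_into_rtrancl rtrancl.rtrancl_into_rtrancl)+
        then show ?case using quasi_transitiveD[OF qA step.IH step.hyps(2)] unfolding adj_def by blast
      qed (rule True)
      then show ?thesis using conn[OF x(1)] un by blast
    next
      case False
      then have xv: "(x, v) \<in> A" using x unfolding adj_def by blast
      have "(y, v) \<in> A" if "(y, x) \<in> A\<^sup>*" for y using that
      proof (induction rule: converse_rtrancl_induct)
        case (step q p)
        have "(v, q) \<notin> A"
          using nS[OF x(1) x(1)] step xv
          by (meson converse_rtrancl_into_rtrancl r_into_rtrancl)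
        then show ?case using quasi_transitiveD[OF qA step.hyps(1) step.IH] unfolding adj_def by blast
      qed (rule xv)
      then show ?thesis using conn[OF _ x(1)] un by blast
    qed
  next
    case False
    have B: "adj B v x" if "x \<in> S" for x using not_adjA[of v x] that SV v False by blast
    \<comment> \<open>Consecutive vertices of an \<open>A\<close>-path cannot lie on different sides
      of \<open>v\<close> in \<open>B\<close>, as quasi-transitivity of \<open>B\<close> would join
      them by \<open>B\<close>. The path stays in \<open>S\<close> because each of its vertices
      still reaches \<open>s\<close>.\<close>
    have "(v, p) \<in> B \<longleftrightarrow> (v, s) \<in> B" if "(s, p) \<in> A\<^sup>*" "(p, s) \<in> A\<^sup>*" for p using that
    proof (induction rule: rtrancl_induct)
      case (step p q)
      have ps: "(p, s) \<in> A\<^sup>*" using step by (meson converse_rtrancl_into_rtrancl)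
      have "p \<in> S" "q \<in> S" using step ps unfolding S by (auto intro: rtrancl_into_rtrancl)
      then have "adj B v p" "adj B v q" using B by auto
      moreover have "\<not> adj B p q" using adj_AB step.hyps(2) unfolding adj_def by blast
      ultimately have "(v, q) \<in> B \<longleftrightarrow> (v, p) \<in> B"
        using quasi_transitiveD[OF qB, of p v q] quasi_transitiveD[OF qB, of q v p] B_asym adj_sym unfolding adj_def by metis
      then show ?case using step.IH[OF ps] by blast
    qed simp
    then have "(\<forall>p\<in>S. (v, p) \<in> B) \<or> (\<forall>p\<in>S. (v, p) \<notin> B)" unfolding S by blast
    then show ?thesis using B un unfolding adj_def by blast
  qed
qed

text \<open>
  A non-adjacent pair of a strong quasi-transitive digraph: \<open>N\<close> is the set of non-neighbours
  of \<open>x\<close>, and \<open>W n\<close> the set of common in-neighbours of \<open>x\<close> and \<open>n\<close>. The sets of those \<open>n\<close>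
  with empty \<open>W n\<close>, and \<open>W z\<close> if no vertex of it is reached by a path of length two from
  \<open>x\<close>, are closed under predecessors and miss \<open>x\<close>.
\<close>

lemma nonadjacent_pair:
  assumes st: "\<And>y. y \<in> V \<Longrightarrow> (x, y) \<in> A\<^sup>*" and B: "adj B x z"
  obtains u v where "(u, v) \<in> A" "(v, x) \<in> A" "(v, z) \<in> A" "(x, u) \<in> A" "(z, u) \<in> A"
proof -
  define N where "N = {n \<in> V. n \<noteq> x \<and> \<not> adj A x n}"
  define W where "W n = {i. (i, x) \<in> A \<and> (i, n) \<in> A}" for n
  have zN: "z \<in> N" using B adjB_V[OF B] adj_AB B_asym unfolding N_def adj_def by blast
  have W1: "W n \<noteq> {}" if "n \<in> N" for n
  proof
    assume "W n = {}"
    have "x \<in> {n \<in> N. W n = {}}"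
    proof (rule closed_pred_reach)
      show "(x, n) \<in> A\<^sup>*" using st that unfolding N_def by blast
      show "n \<in> {n \<in> N. W n = {}}" using that \<open>W n = {}\<close> by blast
      fix p q assume pq: "(p, q) \<in> A" and q: "q \<in> {n \<in> N. W n = {}}"
      have "(x, p) \<notin> A" using pq q quasi_transitiveD[OF qA, of x p q] unfolding N_def by blast
      moreover have "(p, x) \<notin> A" using pq q unfolding W_def by blast
      moreover have "p \<noteq> x" using pq q unfolding N_def adj_def by blast
      ultimately have pN: "p \<in> N" using A_V[OF pq] unfolding N_def adj_def by blast
      \<comment> \<open>Emptiness passes from \<open>W q\<close> to \<open>W p\<close>: the path
        through \<open>p\<close> makes \<open>i\<close> and \<open>q\<close> adjacent, and an arc
        from \<open>q\<close> to \<open>i\<close> would make \<open>q\<close> adjacent to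
        \<open>x\<close>.\<close>
      have "i \<in> W q" if "i \<in> W p" for i
      proof -
        have i: "(i, x) \<in> A" "(i, p) \<in> A" using that unfolding W_def by auto
        have "adj A i q" using quasi_transitiveD[OF qA i(2) pq] .
        moreover have "(q, i) \<notin> A" using quasi_transitiveD[OF qA _ i(1), of q] q unfolding N_def adj_def by blast
        ultimately show ?thesis using i unfolding W_def adj_def by blast
      qed
      then show "p \<in> {n \<in> N. W n = {}}" using pN q by blast
    qed
    then show False unfolding N_def by blast
  qed
  then obtain i where i: "i \<in> W z" using zN by blast
  have "\<exists>v\<in>W z. \<exists>u. (x, u) \<in> A \<and> (u, v) \<in> A"
  proof (rule ccontr)
    assume no: "\<not> ?thesis"
    have "x \<in> W z"
    proof (rule closed_pred_reach)
      show "(x, i) \<in> A\<^sup>*" using st i A_V unfolding W_def by blast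
      show "i \<in> W z" by (rule i)
      fix p q assume pq: "(p, q) \<in> A" and q: "q \<in> W z"
      have q': "(q, x) \<in> A" "(q, z) \<in> A" using q unfolding W_def by auto
      have "(x, p) \<notin> A" using no q pq by blast
      then have px: "(p, x) \<in> A" using quasi_transitiveD[OF qA pq q'(1)] unfolding adj_def by blast
      have "(z, p) \<notin> A" using quasi_transitiveD[OF qA _ px, of z] zN unfolding N_def adj_def by blast
      then have "(p, z) \<in> A" using quasi_transitiveD[OF qA pq q'(2)] unfolding adj_def by blast
      with px show "p \<in> W z" unfolding W_def by blast
    qed
    then show False using A_irrefl unfolding W_def by blast
  qed
  then obtain u v where uv: "v \<in> W z" "(x, u) \<in> A" "(u, v) \<in> A" by blast
  have v: "(v, x) \<in> A" "(v, z) \<in> A" using uv unfolding W_def by auto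
  \<comment> \<open>An arc from \<open>u\<close> to \<open>z\<close> would make \<open>x\<close> and
    \<open>z\<close> adjacent through \<open>u\<close>. So the arc from \<open>u\<close> to
    \<open>v\<close> closes an \<open>A\<close>-cycle with \<open>z\<close> as it does with
    \<open>x\<close>.\<close>
  have "(u, z) \<notin> A" using quasi_transitiveD[OF qA uv(2), of z] zN unfolding N_def by blast
  then have "(z, u) \<in> A" using quasi_transitiveD[OF qA uv(3) v(2)] unfolding adj_def by blast
  then show ?thesis using that uv v by blast
qed

text \<open>The cycle \<open>v\<close>, \<open>X\<close>, \<open>u\<close> keeps \<open>X\<close>
  proper. If a maximal \<open>X\<close> had a \<open>B\<close>-neighbour \<open>z\<close> outside,
  the cycle that \<open>nonadjacent_pair\<close> provides for \<open>z\<close> and a vertex of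
  \<open>X\<close> would extend to all of \<open>insert z X\<close>.\<close>

lemma adjB_in_tour_module:
  assumes st: "\<And>x y. x \<in> V \<Longrightarrow> y \<in> V \<Longrightarrow> (x, y) \<in> A\<^sup>*" and B: "adj B a b"
  obtains M where "tour_module V T M" "M \<noteq> V" "a \<in> M" "b \<in> M"
proof -
  \<comment> \<open>\<open>U\<close> replaces connectedness in \<open>B\<close>: a vertex \<open>A\<close>-adjacent to all of \<open>X\<close> sees \<open>X\<close> uniformly.
    A maximal \<open>X\<close> lying on an \<open>A\<close>-cycle \<open>v \<rightarrow> X \<rightarrow> u \<rightarrow> v\<close> is closed under \<open>B\<close>-adjacency.\<close>
  define U where "U X \<longleftrightarrow> (\<forall>w. (\<forall>x\<in>X. adj A w x) \<longrightarrow> (\<forall>x\<in>X. (w, x) \<in> A) \<or> (\<forall>x\<in>X. (x, w) \<in> A))" for X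
  define G where "G X \<longleftrightarrow> X \<subseteq> V \<and> a \<in> X \<and> U X \<and>
    (\<exists>u v. (u, v) \<in> A \<and> (\<forall>x\<in>X. (v, x) \<in> A \<and> (x, u) \<in> A))" for X
  have aV: "a \<in> V" using adjB_V[OF B] by blast
  obtain u v where "(u, v) \<in> A" "(v, a) \<in> A" "(a, u) \<in> A"
    using nonadjacent_pair[OF st[OF aV] B] by metis
  then have "G {a}" unfolding G_def U_def adj_def using aV by blast
  moreover have "finite {X. G X}"
    by (rule finite_subset[of _ "Pow V"]) (auto simp: G_def fin)
  ultimately obtain X where X: "G X" and max: "\<And>Y. G Y \<Longrightarrow> X \<subseteq> Y \<Longrightarrow> X = Y"
    using finite_has_maximal[of "{X. G X}"] by blast
  from X obtain u v where uv: "(u, v) \<in> A" and vX: "\<And>x. x \<in> X \<Longrightarrow> (v, x) \<in> A"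
    and Xu: "\<And>x. x \<in> X \<Longrightarrow> (x, u) \<in> A" unfolding G_def by blast
  have XV: "X \<subseteq> V" and UX: "U X" and aX: "a \<in> X" using X unfolding G_def by auto
  have closed: "z \<in> X" if x: "x \<in> X" and xz: "adj B x z" for x z
  proof (rule ccontr)
    assume zX: "z \<notin> X"
    have zV: "z \<in> V" using adjB_V[OF xz] by blast
    have nxz: "\<not> adj A x z" using xz adj_AB by blast
    have nzx: "\<not> adj A z x" using nxz adj_sym by metis
    \<comment> \<open>Opposite directions would give an \<open>A\<close>-path of length two between
      \<open>x\<close> and \<open>z\<close>, which are not \<open>A\<close>-adjacent.\<close>
    have dir: "((w, z) \<in> A \<longleftrightarrow> (w, x) \<in> A) \<and> ((z, w) \<in> A \<longleftrightarrow> (x, w) \<in> A)"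
      if "adj A w x" "adj A w z" for w
      using that quasi_transitiveD[OF qA, of x w z] quasi_transitiveD[OF qA, of z w x] nxz nzx A_asym unfolding adj_def by blast
    have UZ: "U (insert z X)" unfolding U_def
    proof (intro allI impI)
      fix w assume w: "\<forall>x\<in>insert z X. adj A w x"
      then have "(\<forall>x\<in>X. (w, x) \<in> A) \<or> (\<forall>x\<in>X. (x, w) \<in> A)" using UX unfolding U_def by blast
      then show "(\<forall>x\<in>insert z X. (w, x) \<in> A) \<or> (\<forall>x\<in>insert z X. (x, w) \<in> A)"
        using dir[of w] w x by blast
    qed
    have ext: False if st': "(s, t) \<in> A" "\<And>y. y \<in> insert z X \<Longrightarrow> (t, y) \<in> A"
        "\<And>y. y \<in> insert z X \<Longrightarrow> (y, s) \<in> A" for s t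
    proof -
      have "G (insert z X)" unfolding G_def using XV zV aX UZ st' by blast
      then show False using max zX by blast
    qed
    have zu: "z \<noteq> u" using nxz Xu[OF x] unfolding adj_def by blast
    have zv: "z \<noteq> v" using nxz vX[OF x] unfolding adj_def by blast
    have ux: "adj A u x" "adj A v x" using Xu[OF x] vX[OF x] unfolding adj_def by blast+
    have "adj A u z \<longleftrightarrow> adj A v z"
    proof
      assume "adj A u z"
      then have "(z, u) \<in> A" using dir[OF ux(1)] Xu[OF x] by blast
      then show "adj A v z" using quasi_transitiveD[OF qA _ uv] adj_sym by metis
    next
      assume "adj A v z"
      then have "(v, z) \<in> A" using dir[OF ux(2)] vX[OF x] by blast
      then show "adj A u z" using quasi_transitiveD[OF qA uv] by metis
    qed
    \<comment> \<open>With both adjacencies, \<open>dir\<close> would let the same \<open>u\<close>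
      and \<open>v\<close> serve for \<open>insert z X\<close>, against maximality; so
      \<open>z\<close> is adjacent to neither.\<close>
    moreover have "\<not> (adj A u z \<and> adj A v z)"
    proof
      assume "adj A u z \<and> adj A v z"
      then have "(z, u) \<in> A" "(v, z) \<in> A" using dir ux Xu[OF x] vX[OF x] by blast+
      then show False using ext[OF uv] vX Xu by blast
    qed
    ultimately have nu: "\<not> adj A u z" "\<not> adj A z u" and nv: "\<not> adj A v z" "\<not> adj A z v"
      using adj_sym by metis+
    obtain s t where st1: "(s, t) \<in> A" "(t, x) \<in> A" "(t, z) \<in> A" "(x, s) \<in> A" "(z, s) \<in> A"
      using nonadjacent_pair[OF st xz] x XV by blast
    \<comment> \<open>Each of the next four arcs is directed by the same argument: the opposite arc
      would, through \<open>s\<close> or \<open>t\<close>, make \<open>z\<close> adjacent to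
      \<open>u\<close> or \<open>v\<close>.\<close>
    have tu: "(t, u) \<in> A"
      using quasi_transitiveD[OF qA st1(2) Xu[OF x]] quasi_transitiveD[OF qA, of u t z] st1(3) nu unfolding adj_def by blast
    have us: "(u, s) \<in> A"
      using quasi_transitiveD[OF qA st1(1) tu] quasi_transitiveD[OF qA, of z s u] st1(5) nu unfolding adj_def by blast
    have vs: "(v, s) \<in> A"
      using quasi_transitiveD[OF qA vX[OF x] st1(4)] quasi_transitiveD[OF qA, of z s v] st1(5) nv unfolding adj_def by blast
    have tv: "(t, v) \<in> A"
      using quasi_transitiveD[OF qA vs st1(1)] quasi_transitiveD[OF qA, of v t z] st1(3) nv unfolding adj_def by blast
    \<comment> \<open>The paths from \<open>t\<close> through \<open>v\<close> to \<open>X\<close>,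
      and from \<open>X\<close> through \<open>u\<close> to \<open>s\<close>, give adjacency to all
      of \<open>X\<close>; then \<open>U X\<close> makes the directions uniform and \<open>x\<close>
      decides them.\<close>
    have "adj A t y" if "y \<in> X" for y
      using quasi_transitiveD[OF qA tv vX[OF that]] .
    then have tX: "\<And>y. y \<in> X \<Longrightarrow> (t, y) \<in> A"
      using UX x st1(2) A_asym unfolding U_def by blast
    have "adj A s y" if "y \<in> X" for y
      using quasi_transitiveD[OF qA Xu[OF that] us] adj_sym by metis
    then have sX: "\<And>y. y \<in> X \<Longrightarrow> (y, s) \<in> A"
      using UX x st1(4) A_asym unfolding U_def by blast
    show False using ext[OF st1(1)] tX sX st1 by blast
  qed
  have "tour_module V T X"
  proof (rule tour_moduleI[OF T XV])
    fix w assume w: "w \<in> V - X"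
    have "adj A w x" if "x \<in> X" for x
      using closed[OF that, of w] not_adjA[of w x] adj_sym that w XV by (metis DiffE subsetD)
    then show "(\<forall>x\<in>X. (w, x) \<in> T) \<or> (\<forall>x\<in>X. (x, w) \<in> T)"
      using UX un unfolding U_def by blast
  qed
  moreover have "X \<noteq> V" using Xu A_V[OF uv] A_irrefl by blast
  ultimately show ?thesis using that aX closed[OF aX B] by blast
qed

lemma cross_B:
  assumes c: "(a, b) \<in> A" "(b, c) \<in> A" "(c, a) \<in> A"
    and out: "\<And>M. tour_module V T M \<Longrightarrow> M \<noteq> V \<Longrightarrow> \<not> {a, b, c} \<subseteq> M"
    and B: "adj B x y"
  obtains M where "tour_module V T M" "M \<noteq> V" "x \<in> M" "y \<in> M"
proof -
  define S where "S = {y. (a, y) \<in> A\<^sup>* \<and> (y, a) \<in> A\<^sup>*}"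
  have "tour_module V T S" using strong_component_tour_module[OF _ S_def] A_V[OF c(1)] by blast
  moreover have "{a, b, c} \<subseteq> S"
    unfolding S_def using c by (auto intro: rtrancl_trans)
  ultimately have "S = V" using out by blast
  then have "\<And>x y. x \<in> V \<Longrightarrow> y \<in> V \<Longrightarrow> (x, y) \<in> A\<^sup>*"
    unfolding S_def by (metis (mono_tags) mem_Collect_eq rtrancl_trans)
  then show ?thesis using adjB_in_tour_module B that by blast
qed

end

section \<open>Strong modules and components of hypergraphs\<close>

lemma hmodule_subset: "hmodule H M \<Longrightarrow> M \<subseteq> hverts H"
  unfolding hmodule_def by blast

lemma hmoduleE:
  assumes "hmodule H M" "e \<in> hedges H" "e \<inter> M \<noteq> {}" "\<not> e \<subseteq> M"
  obtains m where "m \<in> M" "e \<inter> M = {m}" "\<And>n. n \<in> M \<Longrightarrow> insert n (e - {m}) \<in> hedges H"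
proof -
  have "e - M \<noteq> {}" using assms(4) by blast
  then obtain m where "m \<in> M" "e \<inter> M = {m}" "\<forall>n\<in>M. (e - {m}) \<union> {n} \<in> hedges H"
    using assms(1-3) unfolding hmodule_def by blast
  then show ?thesis using that by simp
qed

lemma hmoduleI:
  assumes "M \<subseteq> hverts H"
    and "\<And>e. e \<in> hedges H \<Longrightarrow> e \<inter> M \<noteq> {} \<Longrightarrow> \<not> e \<subseteq> M \<Longrightarrow>
      \<exists>m\<in>M. e \<inter> M = {m} \<and> (\<forall>n\<in>M. insert n (e - {m}) \<in> hedges H)"
  shows "hmodule H M"
  unfolding hmodule_def using assms by (simp add: Diff_eq_empty_iff)

lemma hmodule_induced:
  assumes "hmodule H M" "M \<subseteq> X"
  shows "hmodule (induced_hypergraph H X) M"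
proof (rule hmoduleI)
  fix e assume e: "e \<in> hedges (induced_hypergraph H X)" "e \<inter> M \<noteq> {}" "\<not> e \<subseteq> M"
  then have "e \<in> hedges H" "e \<subseteq> X" by (auto simp: induced_hypergraph_def)
  obtain m where "m \<in> M" "e \<inter> M = {m}" "\<And>n. n \<in> M \<Longrightarrow> insert n (e - {m}) \<in> hedges H"
    using hmoduleE[OF assms(1) \<open>e \<in> hedges H\<close> e(2,3)] by metis
  then show "\<exists>m\<in>M. e \<inter> M = {m} \<and> (\<forall>n\<in>M. insert n (e - {m}) \<in> hedges (induced_hypergraph H X))"
    using \<open>e \<subseteq> X\<close> assms(2) by (intro bexI[of _ m]) (auto simp: induced_hypergraph_def)
qed (use assms in \<open>simp add: induced_hypergraph_def\<close>)

text \<open>An edge not inside \<open>B\<close> meets \<open>B\<close>, and hence \<open>N\<close>,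
  in at most one vertex, and that vertex may already be exchanged within all of
  \<open>B\<close>.\<close>

lemma hmodule_trans:
  assumes B: "hmodule H B" and N: "hmodule (induced_hypergraph H B) N"
  shows "hmodule H N"
proof (rule hmoduleI)
  have NB: "N \<subseteq> B" using hmodule_subset[OF N] by (simp add: induced_hypergraph_def)
  then show "N \<subseteq> hverts H" using hmodule_subset[OF B] by blast
  fix e assume e: "e \<in> hedges H" "e \<inter> N \<noteq> {}" "\<not> e \<subseteq> N"
  show "\<exists>m\<in>N. e \<inter> N = {m} \<and> (\<forall>n\<in>N. insert n (e - {m}) \<in> hedges H)"
  proof (cases "e \<subseteq> B")
    case True
    then have "e \<in> hedges (induced_hypergraph H B)" using e by (simp add: induced_hypergraph_def)
    then obtain m where "m \<in> N" "e \<inter> N = {m}"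
      "\<And>n. n \<in> N \<Longrightarrow> insert n (e - {m}) \<in> hedges (induced_hypergraph H B)"
      using hmoduleE[OF N _ e(2,3)] by metis
    then show ?thesis by (intro bexI[of _ m]) (auto simp: induced_hypergraph_def)
  next
    case False
    have "e \<inter> B \<noteq> {}" using e NB by blast
    then obtain m where m: "m \<in> B" "e \<inter> B = {m}" "\<And>n. n \<in> B \<Longrightarrow> insert n (e - {m}) \<in> hedges H"
      using hmoduleE[OF B e(1) _ False] by metis
    have "e \<inter> N = {m} \<inter> N" unfolding m(2)[symmetric] using NB by blast
    then have "m \<in> N" "e \<inter> N = {m}" using e(2) by auto
    with m(3) NB show ?thesis by (intro bexI[of _ m]) auto
  qed
qed

lemma induced_induced:
  "X \<subseteq> B \<Longrightarrow> induced_hypergraph (induced_hypergraph H B) X = induced_hypergraph H X"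
  by (auto simp: induced_hypergraph_def)

section \<open>Recognizing \<Pi>(H) and the recursion for strong modules\<close>

definition strong_partition :: "'a hypergraph \<Rightarrow> 'a set set \<Rightarrow> bool" where
  "strong_partition H Q \<longleftrightarrow>
     \<Union>Q = hverts H \<and> disjoint Q \<and> {} \<notin> Q \<and> hverts H \<notin> Q \<and> (\<forall>B\<in>Q. strong_hmodule H B) \<and>
     (\<forall>X. strong_hmodule H X \<and> X \<noteq> hverts H \<and> X \<noteq> {} \<longrightarrow> (\<exists>B\<in>Q. X \<subseteq> B))"

lemma
  assumes "strong_partition H Q"
  shows strong_partition_Union: "\<Union>Q = hverts H"
    and strong_partition_disjoint: "disjoint Q"
    and strong_partition_nonempty: "B \<in> Q \<Longrightarrow> B \<noteq> {}"
    and strong_partition_proper: "B \<in> Q \<Longrightarrow> B \<noteq> hverts H"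
    and strong_partition_strong: "B \<in> Q \<Longrightarrow> strong_hmodule H B"
    and strong_partition_finer: "strong_hmodule H X \<Longrightarrow> X \<noteq> hverts H \<Longrightarrow> X \<noteq> {} \<Longrightarrow> \<exists>B\<in>Q. X \<subseteq> B"
  using assms unfolding strong_partition_def by auto

lemma disjoint_eq: "disjoint Q \<Longrightarrow> B \<in> Q \<Longrightarrow> C \<in> Q \<Longrightarrow> x \<in> B \<Longrightarrow> x \<in> C \<Longrightarrow> B = C"
  by (auto simp: disjoint_def)

text \<open>This makes \<open>strong_partition\<close> a criterion that components and maximal
  modules of a tournament can be checked against separately.\<close>

lemma max_strong_hmodules_eq:
  assumes Q: "strong_partition H Q" and V: "hverts H \<noteq> {}"
  shows "max_strong_hmodules H = Q"
proof (intro equalityI subsetI)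
  fix B assume B: "B \<in> Q"
  have "N = B" if N: "strong_hmodule H N" "N \<noteq> hverts H" "B \<subseteq> N" for N
  proof -
    obtain x where x: "x \<in> B" using strong_partition_nonempty[OF Q B] by blast
    then obtain C where C: "C \<in> Q" "N \<subseteq> C" using N strong_partition_finer[OF Q N(1,2)] by blast
    then have "B = C" using disjoint_eq[OF strong_partition_disjoint[OF Q] B C(1) x] x N(3) by blast
    with C N show ?thesis by blast
  qed
  then show "B \<in> max_strong_hmodules H"
    using strong_partition_strong[OF Q B] strong_partition_proper[OF Q B]
    unfolding max_strong_hmodules_def by blast
next
  fix M assume M: "M \<in> max_strong_hmodules H"
  have *: "B = M" if B: "B \<in> Q" "M \<subseteq> B" for B
    using that M strong_partition_strong[OF Q B(1)] strong_partition_proper[OF Q B(1)]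
    unfolding max_strong_hmodules_def by blast
  show "M \<in> Q"
  \<comment> \<open>The empty set counts as a strong module; a nonempty vertex set provides a member
    of \<open>Q\<close> above it.\<close>
  proof (cases "M = {}")
    case True
    obtain B where "B \<in> Q" using strong_partition_Union[OF Q] V by blast
    with * True show ?thesis by blast
  next
    case False
    then obtain B where "B \<in> Q" "M \<subseteq> B"
      using M strong_partition_finer[OF Q, of M] unfolding max_strong_hmodules_def by blast
    with * show ?thesis by blast
  qed
qed

lemma strong_hmodule_hverts:
  assumes "\<And>e. e \<in> hedges H \<Longrightarrow> e \<subseteq> hverts H"
  shows "strong_hmodule H (hverts H)"
  unfolding strong_hmodule_def hmodule_def using assms by blast

text \<open>Modules of \<open>H\<close> inside \<open>B\<close> are exactly the modules of the
  hypergraph induced on \<open>B\<close>. A module of \<open>H\<close> that meets \<open>B\<close>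
  without lying in it contains \<open>B\<close>, so strength is not lost in passing from
  \<open>B\<close> to \<open>H\<close>.\<close>

lemma strong_hmodules_ge2_rec:
  assumes Q: "strong_partition H Q" and F: "\<And>e. e \<in> hedges H \<Longrightarrow> e \<subseteq> hverts H"
    and V: "card (hverts H) \<ge> 2"
  shows "strong_hmodules_ge2 H =
    insert (hverts H) (\<Union>B\<in>Q. strong_hmodules_ge2 (induced_hypergraph H B))"
proof (intro equalityI subsetI)
  fix X assume "X \<in> strong_hmodules_ge2 H"
  then have X: "strong_hmodule H X" "card X \<ge> 2" unfolding strong_hmodules_ge2_def by auto
  show "X \<in> insert (hverts H) (\<Union>B\<in>Q. strong_hmodules_ge2 (induced_hypergraph H B))"
  proof (cases "X = hverts H")
    case False
    moreover have "X \<noteq> {}" using X by auto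
    ultimately obtain B where B: "B \<in> Q" "X \<subseteq> B" using strong_partition_finer[OF Q X(1)] by blast
    have Bm: "hmodule H B" using strong_partition_strong[OF Q B(1)] unfolding strong_hmodule_def by blast
    have "strong_hmodule (induced_hypergraph H B) X"
      using hmodule_induced[OF _ B(2)] hmodule_trans[OF Bm] X(1) unfolding strong_hmodule_def by blast
    then show ?thesis using B X unfolding strong_hmodules_ge2_def by blast
  qed simp
next
  fix X assume "X \<in> insert (hverts H) (\<Union>B\<in>Q. strong_hmodules_ge2 (induced_hypergraph H B))"
  then consider "X = hverts H" | B where "B \<in> Q" "strong_hmodule (induced_hypergraph H B) X" "card X \<ge> 2"
    unfolding strong_hmodules_ge2_def by blast
  then show "X \<in> strong_hmodules_ge2 H"
  proof cases
    case 1
    then show ?thesis using strong_hmodule_hverts[OF F] V unfolding strong_hmodules_ge2_def by blast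
  next
    case 2
    have XB: "X \<subseteq> B"
      using 2(2) hmodule_subset unfolding strong_hmodule_def induced_hypergraph_def by fastforce
    have B: "strong_hmodule H B" using strong_partition_strong[OF Q 2(1)] .
    have "X \<subseteq> N \<or> N \<subseteq> X" if N: "hmodule H N" "X \<inter> N \<noteq> {}" for N
    proof (cases "N \<subseteq> B")
      case True
      then show ?thesis using hmodule_induced[OF N(1) True] 2(2) N(2) unfolding strong_hmodule_def by blast
    next
      case False
      then have "B \<subseteq> N" using B N XB unfolding strong_hmodule_def by blast
      then show ?thesis using XB by blast
    qed
    moreover have "hmodule H X"
      by (rule hmodule_trans[of H B]) (use B 2(2) in \<open>simp_all add: strong_hmodule_def\<close>)
    ultimately have "strong_hmodule H X" unfolding strong_hmodule_def by blast
    with 2(3) show ?thesis by (simp add: strong_hmodules_ge2_def)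
  qed
qed

section \<open>Components as strong modules\<close>

definition link :: "'a hypergraph \<Rightarrow> 'a rel" where
  "link H = {(x, y). \<exists>e\<in>hedges H. x \<in> e \<and> y \<in> e}"

text \<open>The reflexive closure turns a vertex that lies in no edge into a singleton
  component.\<close>

definition components :: "'a hypergraph \<Rightarrow> 'a set set" where
  "components H = (\<lambda>x. (link H)\<^sup>* `` {x}) ` hverts H"

lemma link_sym: "(x, y) \<in> (link H)\<^sup>* \<Longrightarrow> (y, x) \<in> (link H)\<^sup>*"
  using sym_rtrancl[of "link H"] unfolding link_def sym_def by blast

lemma component_edge:
  assumes "C \<in> components H" "e \<in> hedges H" "x \<in> e" "x \<in> C"
  shows "e \<subseteq> C"
proof
  fix y assume "y \<in> e"
  then have "(x, y) \<in> link H" using assms unfolding link_def by blast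
  then show "y \<in> C" using assms unfolding components_def by (auto intro: rtrancl_into_rtrancl)
qed

lemma Union_components:
  assumes "\<And>e. e \<in> hedges H \<Longrightarrow> e \<subseteq> hverts H"
  shows "\<Union>(components H) = hverts H"
proof
  have "y \<in> hverts H" if "(x, y) \<in> (link H)\<^sup>*" "x \<in> hverts H" for x y
    using that by (induction rule: rtrancl_induct) (use assms in \<open>auto simp: link_def\<close>)
  then show "\<Union>(components H) \<subseteq> hverts H" unfolding components_def by blast
qed (auto simp: components_def)

lemma disjoint_components: "disjoint (components H)"
proof -
  have "(link H)\<^sup>* `` {x} = (link H)\<^sup>* `` {y}"
    if "(x, z) \<in> (link H)\<^sup>*" "(y, z) \<in> (link H)\<^sup>*" for x y z
    using that link_sym[of x z H] link_sym[of y z H] by (auto intro: rtrancl_trans)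
  then show ?thesis unfolding disjoint_def components_def by blast
qed

text \<open>A path of links from \<open>x\<close> to a vertex of \<open>C\<close> outside
  \<open>N\<close> leaves \<open>N\<close> at some step; the edge behind that step crosses.\<close>

lemma component_crossing:
  assumes C: "C \<in> components H" and x: "x \<in> C" "x \<in> N" and nC: "\<not> C \<subseteq> N"
  obtains e where "e \<in> hedges H" "e \<subseteq> C" "e \<inter> N \<noteq> {}" "\<not> e \<subseteq> N"
proof -
  obtain y where y: "y \<in> C" "y \<notin> N" using nC by blast
  have "(x, y) \<in> (link H)\<^sup>*"
    using C x(1) y(1) link_sym unfolding components_def
    by (metis (no_types, lifting) Image_singleton_iff imageE rtrancl_trans)
  moreover have "\<exists>p q. (x, p) \<in> (link H)\<^sup>* \<and> (p, q) \<in> link H \<and> p \<in> N \<and> q \<notin> N"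
    if "(x, z) \<in> (link H)\<^sup>*" "z \<notin> N" for z
    using that by (induction rule: rtrancl_induct) (use x in blast)+
  ultimately obtain p q where pq: "(x, p) \<in> (link H)\<^sup>*" "(p, q) \<in> link H" "p \<in> N" "q \<notin> N"
    using y by blast
  then obtain e where e: "e \<in> hedges H" "p \<in> e" "q \<in> e" unfolding link_def by blast
  have "p \<in> C" using pq(1) C x unfolding components_def by (auto intro: rtrancl_trans)
  then have "e \<subseteq> C" using component_edge[OF C e(1,2)] by blast
  then show ?thesis using that e pq by blast
qed

lemma component_hmodule:
  assumes F: "\<And>e. e \<in> hedges H \<Longrightarrow> e \<subseteq> hverts H" and C: "C \<subseteq> components H"
  shows "hmodule H (\<Union>C)"
proof (rule hmoduleI)
  show "\<Union>C \<subseteq> hverts H" using Union_components[OF F] C by blast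
  fix e assume e: "e \<in> hedges H" "e \<inter> \<Union>C \<noteq> {}" "\<not> e \<subseteq> \<Union>C"
  then obtain x D where "D \<in> C" "x \<in> e" "x \<in> D" by blast
  then have "e \<subseteq> D" using component_edge[of D H e x] e(1) C by blast
  with e(3) \<open>D \<in> C\<close> show "\<exists>m\<in>\<Union>C. e \<inter> \<Union>C = {m} \<and> (\<forall>n\<in>\<Union>C. insert n (e - {m}) \<in> hedges H)"
    by blast
qed

text \<open>If a module \<open>N\<close> overlapped \<open>C\<close>, some edge inside
  \<open>C\<close> would meet \<open>N\<close> in a single vertex; exchanging that vertex for one of
  \<open>N\<close> outside \<open>C\<close> would give an edge joining \<open>C\<close> to its
  complement.\<close>

lemma component_strong:
  assumes F: "\<And>e. e \<in> hedges H \<Longrightarrow> e \<subseteq> hverts H" and C: "C \<in> components H"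
  shows "strong_hmodule H C"
  unfolding strong_hmodule_def
proof (intro conjI allI impI)
  show "hmodule H C" using component_hmodule[OF F, of "{C}"] C by simp
  fix N assume N: "hmodule H N \<and> C \<inter> N \<noteq> {}"
  show "C \<subseteq> N \<or> N \<subseteq> C"
  proof (rule ccontr)
    assume *: "\<not> (C \<subseteq> N \<or> N \<subseteq> C)"
    then obtain n where n: "n \<in> N" "n \<notin> C" by blast
    obtain e where e: "e \<in> hedges H" "e \<subseteq> C" "e \<inter> N \<noteq> {}" "\<not> e \<subseteq> N"
      using component_crossing[OF C, of _ N] N * by blast
    obtain m where m: "e \<inter> N = {m}" "\<And>n. n \<in> N \<Longrightarrow> insert n (e - {m}) \<in> hedges H"
      using hmoduleE[of H N e] N e by metis
    obtain y where y: "y \<in> e" "y \<notin> N" using e by blast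
    then have "y \<in> insert n (e - {m})" using m by blast
    then have "n \<in> C" using component_edge[OF C m(2)[OF n(1)], of y] y e by blast
    with n show False by blast
  qed
qed

text \<open>A strong module contained in no component is a union of components. If it is proper, the
  union of one component inside it and one outside it is a module that overlaps it.\<close>

lemma strong_partition_components:
  assumes F: "\<And>e. e \<in> hedges H \<Longrightarrow> e \<subseteq> hverts H" and dis: "hverts H \<notin> components H"
  shows "strong_partition H (components H)"
proof -
  have "\<exists>C\<in>components H. X \<subseteq> C"
    if X: "strong_hmodule H X" "X \<noteq> hverts H" "X \<noteq> {}" for X
  proof (rule ccontr)
    assume no: "\<not> ?thesis"
    have XV: "X \<subseteq> hverts H" using X hmodule_subset unfolding strong_hmodule_def by blast
    have sub: "C \<subseteq> X" if "C \<in> components H" "x \<in> C" "x \<in> X" for C x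
    proof -
      have "strong_hmodule H C" by (rule component_strong[OF F that(1)])
      moreover have "hmodule H X" using X(1) unfolding strong_hmodule_def by blast
      moreover have "C \<inter> X \<noteq> {}" using that by blast
      ultimately have "C \<subseteq> X \<or> X \<subseteq> C" unfolding strong_hmodule_def by blast
      with no that(1) show ?thesis by blast
    qed
    obtain x y where x: "x \<in> X" and y: "y \<in> hverts H" "y \<notin> X" using X XV by blast
    obtain C D where C: "C \<in> components H" "x \<in> C" and D: "D \<in> components H" "y \<in> D"
      using Union_components[OF F] x y XV by blast
    have CX: "C \<subseteq> X" using sub C x by blast
    obtain z where z: "z \<in> X" "z \<notin> C" using no C CX by blast
    have "hmodule H (C \<union> D)" using component_hmodule[OF F, of "{C, D}"] C D by simp
    moreover have "X \<inter> (C \<union> D) \<noteq> {}" using C x by blast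
    ultimately have "X \<subseteq> C \<union> D \<or> C \<union> D \<subseteq> X" using X(1) unfolding strong_hmodule_def by blast
    then have "X \<subseteq> C \<union> D" using y D by blast
    then have "z \<in> D" using z by blast
    then show False using sub D z y by blast
  qed
  moreover have "{} \<notin> components H" unfolding components_def by auto
  ultimately show ?thesis
    unfolding strong_partition_def
    using Union_components[OF F] disjoint_components dis component_strong[OF F] by blast
qed

lemma quotient_components_empty:
  "empty_hypergraph (quotient_hypergraph H (components H))"
proof -
  have "\<not> card {X \<in> components H. X \<inter> e \<noteq> {}} \<ge> 2" if "e \<in> hedges H" for e
  proof -
    have eq: "X = Y" if XY: "X \<in> components H" "X \<inter> e \<noteq> {}" "Y \<in> components H" "Y \<inter> e \<noteq> {}" for X Y
    proof -
      obtain x where x: "x \<in> X" "x \<in> e" using XY(2) by blast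
      obtain y where y: "y \<in> Y" "y \<in> e" using XY(4) by blast
      have "e \<subseteq> X" by (rule component_edge[OF XY(1) \<open>e \<in> hedges H\<close> x(2,1)])
      then show ?thesis using disjoint_eq[OF disjoint_components XY(1,3) _ y(1)] y(2) by blast
    qed
    show ?thesis
    proof
      assume "card {X \<in> components H. X \<inter> e \<noteq> {}} \<ge> 2"
      then have "\<not> card {X \<in> components H. X \<inter> e \<noteq> {}} \<le> Suc 0"
        and "finite {X \<in> components H. X \<inter> e \<noteq> {}}"
        by (auto intro: card_ge_0_finite)
      with eq show False by (simp add: card_le_Suc0_iff_eq)
    qed
  qed
  then show ?thesis unfolding empty_hypergraph_def quotient_hypergraph_def by auto
qed

text \<open>Without edges any two vertices form a module, nontrivial among at least three. Hence the
  two factors of \<open>weight\<close> never occur together.\<close>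

lemma empty_not_prime:
  assumes "empty_hypergraph K"
  shows "\<not> prime_hypergraph K"
proof
  assume p: "prime_hypergraph K"
  then have c: "card (hverts K) \<ge> 3" unfolding prime_hypergraph_def by blast
  then obtain W where W: "W \<subseteq> hverts K" "card W = 2"
    using obtain_subset_with_card_n[of 2 "hverts K"] by auto
  then have "hmodule K W" using assms unfolding hmodule_def empty_hypergraph_def by simp
  then have "trivial_hmodule K W" using p unfolding prime_hypergraph_def by blast
  then show False using W c unfolding trivial_hmodule_def by auto
qed

section \<open>Connected realizable hypergraphs\<close>

text \<open>If two vertices of the cycle lay in \<open>M\<close>, the third would dominate one of
  them and be dominated by the other.\<close>

lemma tour_module_cycle:
  assumes T: "tour V T" and M: "tour_module V T M" and c: "(a, b) \<in> T" "(b, c) \<in> T" "(c, a) \<in> T"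
    and a: "a \<in> M" and n: "\<not> {a, b, c} \<subseteq> M"
  shows "b \<notin> M" "c \<notin> M"
proof -
  have V: "a \<in> V" "b \<in> V" "c \<in> V" using c tour_field[OF T] by auto
  have as: "(b, a) \<notin> T" "(c, b) \<notin> T" "(a, c) \<notin> T" using c tour_asym[OF T] by blast+
  show "b \<notin> M" using tour_moduleD(1)[OF T M V(3) _ a, of b] n a c as by auto
  show "c \<notin> M" using tour_moduleD(1)[OF T M V(2) _ a, of c] n a c as by auto
qed

lemma cyc_rotate:
  assumes "e \<in> cyc T" "x \<in> e"
  obtains b c where "e = {x, b, c}" "(x, b) \<in> T" "(b, c) \<in> T" "(c, x) \<in> T"
proof -
  obtain p q r where e: "e = {p, q, r}" and c: "(p, q) \<in> T" "(q, r) \<in> T" "(r, p) \<in> T"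
    using assms(1) by (rule cycE)
  consider "x = p" | "x = q" | "x = r" using assms(2) e by blast
  then show ?thesis
  proof cases
    case 1 then show ?thesis using that[of q r] e c by simp
  next
    case 2 then show ?thesis using that[of r p] e c by (simp add: insert_commute)
  next
    case 3 then show ?thesis using that[of p q] e c by (simp add: insert_commute)
  qed
qed

text \<open>The converse fails: the first and the last vertex of a transitive tournament on three
  vertices form a module of its edgeless hypergraph only.\<close>

lemma tour_module_hmodule:
  assumes T: "tour (hverts H) T" and F: "hedges H = cyc T" and M: "tour_module (hverts H) T M"
  shows "hmodule H M"
proof (rule hmoduleI)
  show "M \<subseteq> hverts H" using M unfolding tour_module_def by blast
  fix e assume e: "e \<in> hedges H" "e \<inter> M \<noteq> {}" "\<not> e \<subseteq> M"
  obtain a where a: "a \<in> e" "a \<in> M" using e(2) by blast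
  obtain b c where abc: "e = {a, b, c}" "(a, b) \<in> T" "(b, c) \<in> T" "(c, a) \<in> T"
    using cyc_rotate[of e T a] e(1) a(1) F by metis
  have n: "b \<notin> M" "c \<notin> M" using tour_module_cycle[OF T M abc(2-4) a(2)] e(3) abc(1) by auto
  have V: "b \<in> hverts H" "c \<in> hverts H" using tour_field[OF T] abc by auto
  have "a \<noteq> b" "a \<noteq> c" using n a by auto
  then have ea: "e - {a} = {b, c}" unfolding abc(1) by blast
  have "insert x (e - {a}) \<in> hedges H" if x: "x \<in> M" for x
  proof -
    have "(x, b) \<in> T" using tour_moduleD(2)[OF T M V(1) n(1) a(2) x] abc(2) by blast
    moreover have "(c, x) \<in> T" using tour_moduleD(1)[OF T M V(2) n(2) a(2) x] abc(4) by blast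
    ultimately show ?thesis unfolding ea F using cycI abc(3) by metis
  qed
  moreover have "e \<inter> M = {a}" using abc(1) n a(2) by blast
  ultimately show "\<exists>m\<in>M. e \<inter> M = {m} \<and> (\<forall>n\<in>M. insert n (e - {m}) \<in> hedges H)"
    using a(2) by blast
qed

lemma tour_module_Un:
  assumes "tour_module V T M" "tour_module V T N" "M \<inter> N \<noteq> {}"
  shows "tour_module V T (M \<union> N)"
proof -
  obtain z where z: "z \<in> M" "z \<in> N" using assms(3) by blast
  have z': "(v, x) \<in> T \<longleftrightarrow> (v, z) \<in> T" if "v \<in> V - (M \<union> N)" "x \<in> M \<union> N" for v x
    using that assms(1,2) z unfolding tour_module_def by blast
  show ?thesis unfolding tour_module_def
  proof (intro conjI ballI)
    show "M \<union> N \<subseteq> V" using assms(1,2) unfolding tour_module_def by simp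
    fix v x y assume "v \<in> V - (M \<union> N)" "x \<in> M \<union> N" "y \<in> M \<union> N"
    then show "(v, x) \<in> T \<longleftrightarrow> (v, y) \<in> T" using z'[of v x] z'[of v y] by simp
  qed
qed

locale connected_realization =
  fixes H :: "'a hypergraph" and T :: "'a rel"
  assumes fin: "finite (hverts H)" and T: "tour (hverts H) T" and F: "hedges H = cyc T"
    and conn: "hverts H \<in> components H" and two: "card (hverts H) \<ge> 2"
begin

abbreviation "V \<equiv> hverts H"

lemma edge_V: "e \<in> hedges H \<Longrightarrow> e \<subseteq> V"
  using cyc_sub[OF T] F by blast

lemma crossing_edge:
  assumes "M \<subseteq> V" "M \<noteq> V" "M \<noteq> {}"
  obtains e where "e \<in> hedges H" "e \<inter> M \<noteq> {}" "\<not> e \<subseteq> M"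
proof -
  obtain x where "x \<in> M" using assms by blast
  then show ?thesis using component_crossing[OF conn, of x M] that assms by blast
qed

text \<open>Some edge meets both sides by connectedness, and a 3-cycle that leaves \<open>X\<close>
  has to come back by an arc into \<open>X\<close>.\<close>

lemma no_cut:
  assumes X: "X \<subseteq> V" "X \<noteq> V" "X \<noteq> {}"
  shows "\<not> (\<forall>x\<in>X. \<forall>y\<in>V - X. (x, y) \<in> T)"
proof
  assume cut: "\<forall>x\<in>X. \<forall>y\<in>V - X. (x, y) \<in> T"
  obtain e where e: "e \<in> hedges H" "e \<inter> X \<noteq> {}" "\<not> e \<subseteq> X" using crossing_edge[OF X] .
  then obtain x where x: "x \<in> e" "x \<notin> X" by blast
  obtain b c where c: "e = {x, b, c}" "(x, b) \<in> T" "(b, c) \<in> T" "(c, x) \<in> T"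
    using cyc_rotate[of e T x] e(1) x(1) F by metis
  have V: "x \<in> V" "b \<in> V" "c \<in> V" using edge_V[OF e(1)] c(1) by auto
  have "b \<notin> X" using cut x(2) V c(2) tour_asym[OF T] by blast
  then have "c \<notin> X" using cut V c(3) tour_asym[OF T] by blast
  with \<open>b \<notin> X\<close> x(2) e(2) c(1) show False by blast
qed

lemma hmodule_in_tour_module:
  assumes M: "hmodule H M" "M \<noteq> V" "M \<noteq> {}"
  obtains N where "tour_module V T N" "N \<noteq> V" "M \<subseteq> N"
proof -
  have MV: "M \<subseteq> V" using hmodule_subset[OF M(1)] .
  \<comment> \<open>No edge meets both \<open>M\<close> and the vertices splitting \<open>M\<close>, so adding these gives a module of \<open>T\<close>.\<close>
  define S where "S = {v \<in> V - M. \<exists>x\<in>M. \<exists>y\<in>M. (v, x) \<in> T \<and> (y, v) \<in> T}"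
  have no_edge: False if e: "e \<in> hedges H" "e \<inter> M \<noteq> {}" "\<not> e \<subseteq> M" and v: "v \<in> S" "v \<in> e" for e v
  proof -
    obtain x y where xy: "v \<notin> M" "x \<in> M" "y \<in> M" "(v, x) \<in> T" "(y, v) \<in> T"
      using v(1) unfolding S_def by blast
    obtain m where m: "e \<inter> M = {m}" "\<And>n. n \<in> M \<Longrightarrow> insert n (e - {m}) \<in> hedges H"
      using hmoduleE[OF M(1) e] by metis
    have "m \<in> e" "v \<noteq> m" using m(1) xy(1) by blast+
    have "card e = 3" using cyc_card[OF T] e(1) F by blast
    then have "card (e - {m} - {v}) = 1" using \<open>m \<in> e\<close> \<open>v \<noteq> m\<close> v(2)
      by (simp add: card_Diff_singleton_if)
    then obtain w where "e - {m} - {v} = {w}" by (rule card_1_singletonE)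
    then have em: "e - {m} = {v, w}" using v(2) \<open>v \<noteq> m\<close> by blast
    \<comment> \<open>Since \<open>v\<close> dominates \<open>x\<close> and is dominated by
      \<open>y\<close>, these two 3-cycles direct the pair \<open>v\<close>, \<open>w\<close> in
      opposite ways.\<close>
    have "{x, v, w} \<in> cyc T" "{y, v, w} \<in> cyc T" using m(2) xy em F by auto
    then show False using xy(4,5) tour_asym[OF T] unfolding cyc_iff[OF T] by blast
  qed
  have "tour_module V T (M \<union> S)"
  proof (rule tour_moduleI[OF T])
    show "M \<union> S \<subseteq> V" using MV unfolding S_def by blast
    fix v assume v: "v \<in> V - (M \<union> S)"
    have ne: "{v, s, x} \<notin> hedges H" if "s \<in> S" "x \<in> M" for s x
      using no_edge[of "{v, s, x}" s] that v by auto
    have sV: "s \<in> V" "s \<noteq> v" if "s \<in> S" for s using that v unfolding S_def by blast+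
    have sxy: "\<exists>x\<in>M. \<exists>y\<in>M. (s, x) \<in> T \<and> (y, s) \<in> T" if "s \<in> S" for s
      using that unfolding S_def by blast
    have "(\<forall>x\<in>M. (v, x) \<in> T) \<or> (\<forall>x\<in>M. (v, x) \<notin> T)"
    proof (rule ccontr)
      assume "\<not> ?thesis"
      then obtain x y where xy: "x \<in> M" "y \<in> M" "(v, x) \<in> T" "(v, y) \<notin> T" by blast
      then have "(y, v) \<in> T" using tour_total[OF T, of v y] v MV by blast
      then show False using xy v unfolding S_def by blast
    qed
    then show "(\<forall>x\<in>M \<union> S. (v, x) \<in> T) \<or> (\<forall>x\<in>M \<union> S. (x, v) \<in> T)"
    proof
      assume a: "\<forall>x\<in>M. (v, x) \<in> T"
      \<comment> \<open>As \<open>s\<close> splits \<open>M\<close>, a wrong direction would close a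
        3-cycle on \<open>v\<close>, \<open>s\<close> and a vertex of \<open>M\<close>, excluded by
        \<open>ne\<close>. The case below is symmetric.\<close>
      have "(v, s) \<in> T" if s: "s \<in> S" for s
      proof (rule ccontr)
        assume "(v, s) \<notin> T"
        then have "(s, v) \<in> T" using tour_total[OF T, of v s] v sV[OF s] by blast
        moreover obtain y where y: "y \<in> M" "(y, s) \<in> T" using sxy[OF s] by blast
        ultimately have "{v, y, s} \<in> cyc T" using cycI[of v y T s] a by blast
        then show False using ne[OF s y(1)] F by (simp add: insert_commute)
      qed
      with a show ?thesis by blast
    next
      assume "\<forall>x\<in>M. (v, x) \<notin> T"
      then have a: "\<forall>x\<in>M. (x, v) \<in> T" using tour_total[OF T, of v] v MV by blast
      have "(s, v) \<in> T" if s: "s \<in> S" for s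
      proof (rule ccontr)
        assume "(s, v) \<notin> T"
        then have "(v, s) \<in> T" using tour_total[OF T, of s v] v sV[OF s] by blast
        moreover obtain x where x: "x \<in> M" "(s, x) \<in> T" using sxy[OF s] by blast
        ultimately have "{v, s, x} \<in> cyc T" using cycI[of v s T x] a by blast
        then show False using ne[OF s x(1)] F by simp
      qed
      with a show ?thesis by blast
    qed
  qed
  moreover have "M \<union> S \<noteq> V"
  proof
    assume eq: "M \<union> S = V"
    \<comment> \<open>Connectedness gives an edge leaving \<open>M\<close>; its vertices outside
      \<open>M\<close> cannot be in \<open>S\<close>, by \<open>no_edge\<close>.\<close>
    obtain e where e: "e \<in> hedges H" "e \<inter> M \<noteq> {}" "\<not> e \<subseteq> M" using crossing_edge[OF MV M(2,3)] .
    then obtain v where v: "v \<in> e" "v \<notin> M" by blast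
    then have "v \<in> S" using edge_V[OF e(1)] eq by blast
    then show False using no_edge[OF e _ v(1)] by blast
  qed
  ultimately show ?thesis using that by blast
qed

section \<open>Maximal proper modules of a realization\<close>

definition blocks :: "'a set set" where
  "blocks = {M. tour_module V T M \<and> M \<noteq> V \<and> M \<noteq> {} \<and> (\<forall>N. tour_module V T N \<and> N \<noteq> V \<and> M \<subseteq> N \<longrightarrow> N = M)}"

lemma blocksD:
  assumes "B \<in> blocks"
  shows "tour_module V T B" "B \<noteq> V" "B \<noteq> {}" "tour_module V T N \<Longrightarrow> N \<noteq> V \<Longrightarrow> B \<subseteq> N \<Longrightarrow> N = B" "B \<subseteq> V"
proof -
  show 1: "tour_module V T B" and "B \<noteq> V" "B \<noteq> {}" and "tour_module V T N \<Longrightarrow> N \<noteq> V \<Longrightarrow> B \<subseteq> N \<Longrightarrow> N = B"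
    using assms unfolding blocks_def by simp_all
  show "B \<subseteq> V" using 1 unfolding tour_module_def by simp
qed

lemma tour_module_in_block:
  assumes M: "tour_module V T M" "M \<noteq> V" "M \<noteq> {}"
  obtains B where "B \<in> blocks" "M \<subseteq> B"
proof -
  let ?P = "{N. tour_module V T N \<and> N \<noteq> V}"
  have "finite ?P" by (rule finite_subset[of _ "Pow V"]) (auto simp: tour_module_def fin)
  moreover have "M \<in> ?P" using M by blast
  ultimately obtain B where B: "B \<in> ?P" "M \<subseteq> B" "\<forall>N\<in>?P. B \<subseteq> N \<longrightarrow> B = N"
    using finite_has_maximal2[of ?P M] by blast
  then have "B \<in> blocks" unfolding blocks_def using M(3) by auto
  then show ?thesis using that B(2) by blast
qed

text \<open>If \<open>M\<close> and \<open>N\<close> covered \<open>V\<close>, exchanging ends first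
  in \<open>N\<close>, then in \<open>M\<close>, would give all arcs between \<open>V - N\<close>
  and \<open>N\<close> the direction of a single one, contrary to \<open>no_cut\<close>.\<close>

lemma Un_tour_module_proper:
  assumes M: "tour_module V T M" "M \<noteq> V" and N: "tour_module V T N" "N \<noteq> V"
  shows "M \<union> N \<noteq> V"
proof
  assume eq: "M \<union> N = V"
  have MV: "M \<subseteq> V" "N \<subseteq> V" using M N unfolding tour_module_def by auto
  obtain p q where p: "p \<in> V" "p \<notin> N" "p \<in> M" and q: "q \<in> V" "q \<notin> M" "q \<in> N"
    using M N MV eq by blast
  have d: "((x, z) \<in> T \<longleftrightarrow> (p, q) \<in> T) \<and> ((z, x) \<in> T \<longleftrightarrow> (q, p) \<in> T)" if x: "x \<in> V - N" and z: "z \<in> N" for x z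
  proof -
    have xM: "x \<in> V" "x \<notin> N" "x \<in> M" using x eq by auto
    show ?thesis
      using tour_moduleD[OF T N(1) xM(1,2) z q(3)] tour_moduleD[OF T M(1) q(1,2) xM(3) p(3)] by blast
  qed
  have "p \<noteq> q" using p q by blast
  then consider "(p, q) \<in> T" | "(q, p) \<in> T" using tour_total[OF T p(1) q(1)] by blast
  then show False
  proof cases
    case 1
    then show False using no_cut[of "V - N"] d p q by blast
  next
    case 2
    then show False using no_cut[of N] d p q MV by blast
  qed
qed

lemma disjoint_blocks: "disjoint blocks"
  unfolding disjoint_def
proof (intro ballI impI)
  fix B C assume B: "B \<in> blocks" and C: "C \<in> blocks" and ne: "B \<noteq> C"
  show "B \<inter> C = {}"
  proof (rule ccontr)
    assume "B \<inter> C \<noteq> {}"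
    then have m: "tour_module V T (B \<union> C)" using tour_module_Un blocksD(1) B C by blast
    have "B \<union> C \<noteq> V" using Un_tour_module_proper blocksD(1,2) B C by blast
    then have "B \<union> C = B" "B \<union> C = C" using blocksD(4)[OF B m] blocksD(4)[OF C m] by auto
    with ne show False by blast
  qed
qed

lemma singleton_tour_module: "x \<in> V \<Longrightarrow> tour_module V T {x}"
  unfolding tour_module_def by simp

lemma Union_blocks: "\<Union>blocks = V"
proof
  show "\<Union>blocks \<subseteq> V" using blocksD(5) by blast
  show "V \<subseteq> \<Union>blocks"
  proof
    fix x assume x: "x \<in> V"
    have "card {x} \<noteq> card V" using two by simp
    then have "{x} \<noteq> V" by metis
    then obtain B where "B \<in> blocks" "{x} \<subseteq> B" using tour_module_in_block[OF singleton_tour_module[OF x]] by blast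
    then show "x \<in> \<Union>blocks" by blast
  qed
qed

lemma hmodule_in_block:
  assumes M: "hmodule H M" "M \<noteq> V" "M \<noteq> {}"
  obtains B where "B \<in> blocks" "M \<subseteq> B"
proof -
  obtain N where N: "tour_module V T N" "N \<noteq> V" "M \<subseteq> N" using hmodule_in_tour_module[OF M] .
  obtain B where "B \<in> blocks" "N \<subseteq> B" using tour_module_in_block[OF N(1,2)] N(3) M(3) by blast
  then show ?thesis using that N(3) by blast
qed

lemma block_strong:
  assumes B: "B \<in> blocks"
  shows "strong_hmodule H B"
  unfolding strong_hmodule_def
proof (intro conjI allI impI)
  show "hmodule H B" by (rule tour_module_hmodule[OF T F blocksD(1)[OF B]])
  fix N assume N: "hmodule H N \<and> B \<inter> N \<noteq> {}"
  show "B \<subseteq> N \<or> N \<subseteq> B"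
  proof (cases "N = V")
    case True
    then show ?thesis using blocksD(5)[OF B] by blast
  next
    case False
    then obtain C where C: "C \<in> blocks" "N \<subseteq> C" using hmodule_in_block[of N] N by (metis inf_bot_right)
    obtain x where "x \<in> B" "x \<in> N" using N by blast
    then have "B = C" using disjoint_eq[OF disjoint_blocks B C(1), of x] C(2) by blast
    with C show ?thesis by blast
  qed
qed

lemma strong_partition_blocks: "strong_partition H blocks"
proof -
  have "{} \<notin> blocks" "V \<notin> blocks" using blocksD(2,3) by blast+
  moreover have "\<exists>B\<in>blocks. X \<subseteq> B" if X: "strong_hmodule H X" "X \<noteq> V" "X \<noteq> {}" for X
  proof -
    have "hmodule H X" using X(1) unfolding strong_hmodule_def by blast
    then show ?thesis using hmodule_in_block[OF _ X(2,3)] by metis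
  qed
  ultimately show ?thesis
    unfolding strong_partition_def using Union_blocks disjoint_blocks block_strong by simp
qed

text \<open>Any edge that meets a block and leaves it will do: a proper module containing it would
  lie in a block sharing a vertex with the first one, hence equal to it.\<close>

lemma crossing_triple:
  obtains e where "e \<in> hedges H" "\<And>M. tour_module V T M \<Longrightarrow> M \<noteq> V \<Longrightarrow> \<not> e \<subseteq> M"
proof -
  have "V \<noteq> {}" using two by (metis card.empty not_numeral_le_zero)
  then obtain x where x: "x \<in> V" by blast
  then obtain B where B: "B \<in> blocks" using Union_blocks by blast
  obtain e where e: "e \<in> hedges H" "e \<inter> B \<noteq> {}" "\<not> e \<subseteq> B"
    using crossing_edge[OF blocksD(5,2,3)[OF B]] .
  have "\<not> e \<subseteq> M" if M: "tour_module V T M" "M \<noteq> V" for M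
  proof
    assume eM: "e \<subseteq> M"
    then have "M \<noteq> {}" using e(2) by blast
    then obtain C where C: "C \<in> blocks" "M \<subseteq> C" using tour_module_in_block[OF M] by blast
    obtain y where "y \<in> e" "y \<in> B" using e(2) by blast
    then have "B = C" using disjoint_eq[OF disjoint_blocks B C(1), of y] C(2) eM by blast
    with C(2) eM e(3) show False by blast
  qed
  with e(1) that show ?thesis by blast
qed

lemma edge_inter_block:
  assumes B: "B \<in> blocks" and e: "e \<in> hedges H" "\<not> e \<subseteq> B" "x \<in> e" "y \<in> e" "x \<in> B" "y \<in> B"
  shows "x = y"
proof -
  have "hmodule H B" using block_strong[OF B] unfolding strong_hmodule_def by blast
  then obtain m where "e \<inter> B = {m}" using hmoduleE[of H B e] e by (metis disjoint_iff)
  moreover have "x \<in> e \<inter> B" "y \<in> e \<inter> B" using e by blast+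
  ultimately show ?thesis by simp
qed

end

section \<open>Two realizations of a connected hypergraph\<close>

text \<open>The equation \<open>cross Q K = K\<close> serves below to say that \<open>K\<close>
  consists of crossing pairs only.\<close>

definition cross :: "'a set set \<Rightarrow> 'a rel \<Rightarrow> 'a rel" where
  "cross Q R = R - (\<Union>B\<in>Q. B \<times> B)"

definition glue :: "'a set set \<Rightarrow> 'a rel \<Rightarrow> ('a set \<Rightarrow> 'a rel) \<Rightarrow> 'a rel" where
  "glue Q K g = K \<union> (\<Union>B\<in>Q. g B)"

lemma cross_iff: "(x, y) \<in> cross Q R \<longleftrightarrow> (x, y) \<in> R \<and> \<not> (\<exists>B\<in>Q. x \<in> B \<and> y \<in> B)"
  unfolding cross_def by blast

text \<open>If two consecutive arcs are both kept or both reversed, they still form a directed path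
  in \<open>T'\<close>. The triple is a 3-cycle of both tournaments or of neither, so the third pair
  is treated in the same way.\<close>

lemma quasi_transitive_agreement:
  assumes T: "tour V T" and T': "tour V T'" and eq: "cyc T' = cyc T"
  shows "quasi_transitive (T \<inter> T')" "quasi_transitive (T - T')"
proof -
  have c: "{x, y, z} \<in> cyc T \<longleftrightarrow> {x, y, z} \<in> cyc T'" for x y z using eq by simp
  note c = c[unfolded cyc_iff[OF T] cyc_iff[OF T']]
  have xz: "(x, z) \<in> T \<or> (z, x) \<in> T" "(x, z) \<in> T' \<or> (z, x) \<in> T'"
    if "(x, y) \<in> T" "(y, z) \<in> T" for x y z
  proof -
    have "x \<noteq> z" "x \<in> V" "z \<in> V" using that tour_asym[OF T] tour_field[OF T] by blast+
    then show "(x, z) \<in> T \<or> (z, x) \<in> T" "(x, z) \<in> T' \<or> (z, x) \<in> T'"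
      using tour_total[OF T] tour_total[OF T'] by blast+
  qed
  show "quasi_transitive (T \<inter> T')" unfolding quasi_transitive_def
  proof (intro allI impI)
    fix x y z assume a: "(x, y) \<in> T \<inter> T' \<and> (y, z) \<in> T \<inter> T'"
    then have "(x, y) \<in> T" "(y, z) \<in> T" "(x, y) \<in> T'" "(y, z) \<in> T'"
      "(y, x) \<notin> T" "(z, y) \<notin> T" "(y, x) \<notin> T'" "(z, y) \<notin> T'"
      using tour_asym[OF T] tour_asym[OF T'] by blast+
    then show "adj (T \<inter> T') x z" using c[of x y z] xz[of x y z] unfolding adj_def by simp metis
  qed
  show "quasi_transitive (T - T')" unfolding quasi_transitive_def
  proof (intro allI impI)
    fix x y z assume a: "(x, y) \<in> T - T' \<and> (y, z) \<in> T - T'"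
    then have 1: "(x, y) \<in> T" "(y, z) \<in> T" "(x, y) \<notin> T'" "(y, z) \<notin> T'"
      "(y, x) \<notin> T" "(z, y) \<notin> T" using tour_asym[OF T] by blast+
    moreover have "(y, x) \<in> T'" "(z, y) \<in> T'"
      using 1 tour_total[OF T'] tour_field[OF T] tour_irrefl[OF T] by metis+
    moreover have "\<not> ((x, z) \<in> T' \<and> (z, x) \<in> T')" "\<not> ((x, z) \<in> T \<and> (z, x) \<in> T)"
      using tour_asym[OF T] tour_asym[OF T'] by blast+
    ultimately show "adj (T - T') x z" using c[of x y z] xz[of x y z] unfolding adj_def by simp metis
  qed
qed

text \<open>One inclusion is enough, because each tournament directs every crossing pair exactly
  once.\<close>

lemma cross_eq:
  assumes T: "tour V T" and R: "tour V R" and sub: "cross Q T \<subseteq> R"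
  shows "cross Q R = cross Q T"
proof -
  have "(x, y) \<in> T" if xy: "(x, y) \<in> cross Q R" for x y
  proof (rule ccontr)
    assume "(x, y) \<notin> T"
    moreover have "(x, y) \<in> R" using xy unfolding cross_def by blast
    moreover have "x \<in> V" "y \<in> V" "x \<noteq> y"
      using tour_field[OF R] tour_irrefl[OF R] \<open>(x, y) \<in> R\<close> by blast+
    ultimately have "(y, x) \<in> T" using tour_total[OF T] by blast
    then have "(y, x) \<in> cross Q T" using xy unfolding cross_iff by blast
    then show False using sub tour_asym[OF R \<open>(x, y) \<in> R\<close>] by blast
  qed
  then have "p \<in> cross Q R \<longleftrightarrow> p \<in> cross Q T" for p
    using subsetD[OF sub, of p] by (cases p) (metis cross_iff)
  then show ?thesis by blast
qed

lemma tour_converse: "tour V R \<Longrightarrow> tour V (R\<inverse>)"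
  by (rule tourI) (use tour_field tour_asym tour_total in \<open>fast+\<close>)

lemma cyc_converse: "cyc (R\<inverse>) = cyc R"
proof -
  have "cyc R \<subseteq> cyc (R\<inverse>)" for R :: "'a rel"
  proof
    fix e assume "e \<in> cyc R"
    then obtain a b c where "e = {a, b, c}" "(a, b) \<in> R" "(b, c) \<in> R" "(c, a) \<in> R" by (rule cycE)
    then show "e \<in> cyc (R\<inverse>)" using cycI[of c b "R\<inverse>" a] by (simp add: insert_commute)
  qed
  from this[of R] this[of "R\<inverse>"] show ?thesis by auto
qed

lemma cross_converse: "cross Q (R\<inverse>) = (cross Q R)\<inverse>"
  unfolding cross_def by blast

lemma (in connected_realization) realization_cross:
  assumes R: "tour V R" and eq: "cyc R = cyc T"
  shows "cross blocks R = cross blocks T \<or> cross blocks R = (cross blocks T)\<inverse>"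
proof -
  note qts = quasi_transitive_agreement[OF T R eq]
  have c1: "two_coloured V T (T \<inter> R) (T - R)"
    by unfold_locales (use fin T qts in blast)+
  have c2: "two_coloured V T (T - R) (T \<inter> R)"
    by unfold_locales (use fin T qts in blast)+
  obtain e where e: "e \<in> hedges H" and out: "\<And>M. tour_module V T M \<Longrightarrow> M \<noteq> V \<Longrightarrow> \<not> e \<subseteq> M"
    using crossing_triple by metis
  obtain a b c where abc: "e = {a, b, c}" and T3: "(a, b) \<in> T" "(b, c) \<in> T" "(c, a) \<in> T"
    using e F by (metis cycE)
  note out' = out[unfolded abc]
  have in_block: "(x, y) \<notin> cross blocks T" if M: "tour_module V T M" "M \<noteq> V" "x \<in> M" "y \<in> M" for M x y
  proof -
    obtain C where "C \<in> blocks" "M \<subseteq> C" using tour_module_in_block[OF M(1,2)] M(3) by blast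
    then show ?thesis using M(3,4) unfolding cross_iff by blast
  qed
  have "{a, b, c} \<in> cyc R" using e abc F eq by simp
  \<comment> \<open>Both tournaments direct this triple cyclically, so they agree on all three arcs
    or on none; this decides which colour plays the role of \<open>A\<close>.\<close>
  then consider "(a, b) \<in> R" "(b, c) \<in> R" "(c, a) \<in> R" | "(a, c) \<in> R" "(c, b) \<in> R" "(b, a) \<in> R"
    unfolding cyc_iff[OF R] by blast
  then show ?thesis
  proof cases
    case 1
    then have A3: "(a, b) \<in> T \<inter> R" "(b, c) \<in> T \<inter> R" "(c, a) \<in> T \<inter> R" using T3 by auto
    have "(x, y) \<in> R" if xy: "(x, y) \<in> cross blocks T" for x y
    proof (rule ccontr)
      assume "(x, y) \<notin> R"
      then have "adj (T - R) x y" using xy unfolding adj_def cross_iff by blast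
      then obtain M where "tour_module V T M" "M \<noteq> V" "x \<in> M" "y \<in> M"
        using two_coloured.cross_B[OF c1 A3 out'] by blast
      then show False using in_block xy by blast
    qed
    then have "cross blocks T \<subseteq> R" by auto
    then show ?thesis using cross_eq[OF T R] by blast
  next
    case 2
    then have A3: "(a, b) \<in> T - R" "(b, c) \<in> T - R" "(c, a) \<in> T - R" using T3 tour_asym[OF R] by blast+
    have "(x, y) \<in> R\<inverse>" if xy: "(x, y) \<in> cross blocks T" for x y
    proof (rule ccontr)
      assume "(x, y) \<notin> R\<inverse>"
      moreover have xyT: "(x, y) \<in> T" using xy unfolding cross_iff by blast
      moreover have "x \<in> V" "y \<in> V" "x \<noteq> y" using tour_field[OF T xyT] xyT tour_irrefl[OF T] by auto
      ultimately have "(x, y) \<in> R" using tour_total[OF R, of y x] by blast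
      then have "adj (T \<inter> R) x y" using xyT unfolding adj_def by blast
      then obtain M where "tour_module V T M" "M \<noteq> V" "x \<in> M" "y \<in> M"
        using two_coloured.cross_B[OF c2 A3 out'] by blast
      then show False using in_block xy by blast
    qed
    then have "cross blocks T \<subseteq> R\<inverse>" by auto
    then have "cross blocks (R\<inverse>) = cross blocks T" using cross_eq[OF T tour_converse[OF R]] by blast
    then show ?thesis unfolding cross_converse by (metis converse_converse)
  qed
qed

text \<open>The two values come from \<open>T\<close> and its converse. They are distinct because an
  edge inside no proper module has no two vertices in one block, so crossing arcs exist.\<close>

lemma (in connected_realization) card_cross: "card (cross blocks ` realizing V (hedges H)) = 2"
proof -
  have TR: "T \<in> realizing V (hedges H)" "T\<inverse> \<in> realizing V (hedges H)"
    using T F unfolding realizing_def by (auto simp: tour_converse cyc_converse)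
  have "cross blocks ` realizing V (hedges H) = {cross blocks T, (cross blocks T)\<inverse>}"
  proof (intro equalityI subsetI)
    fix K assume "K \<in> cross blocks ` realizing V (hedges H)"
    then show "K \<in> {cross blocks T, (cross blocks T)\<inverse>}"
      using realization_cross F unfolding realizing_def by auto
  next
    fix K assume "K \<in> {cross blocks T, (cross blocks T)\<inverse>}"
    then show "K \<in> cross blocks ` realizing V (hedges H)"
      using TR cross_converse by (metis image_eqI insertE singletonD)
  qed
  moreover have "cross blocks T \<noteq> (cross blocks T)\<inverse>"
  proof
    assume eq: "cross blocks T = (cross blocks T)\<inverse>"
    obtain e where e: "e \<in> hedges H" and out: "\<And>M. tour_module V T M \<Longrightarrow> M \<noteq> V \<Longrightarrow> \<not> e \<subseteq> M"
      using crossing_triple by metis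
    obtain a b c where abc: "e = {a, b, c}" and T3: "(a, b) \<in> T" "(b, c) \<in> T" "(c, a) \<in> T"
      using e F by (metis cycE)
    have "\<not> (\<exists>B\<in>blocks. a \<in> B \<and> b \<in> B)"
    proof
      assume "\<exists>B\<in>blocks. a \<in> B \<and> b \<in> B"
      then obtain B where B: "B \<in> blocks" "a \<in> B" "b \<in> B" by blast
      have "\<not> e \<subseteq> B" using out blocksD(1,2)[OF B(1)] by blast
      then have "a = b" using edge_inter_block[OF B(1) e, of a b] B abc by simp
      then show False using T3(1) tour_irrefl[OF T] by blast
    qed
    then have ab: "(a, b) \<in> cross blocks T" using T3(1) unfolding cross_iff by blast
    then have "(b, a) \<in> cross blocks T" using eq by blast
    then show False using ab tour_asym[OF T] unfolding cross_iff by blast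
  qed
  ultimately show ?thesis by simp
qed

section \<open>Gluing realizations along a partition\<close>

lemma Collect_cyc_subset: "tour V R \<Longrightarrow> {e \<in> cyc R. e \<subseteq> B} = cyc (R \<inter> B \<times> B)"
proof (intro equalityI subsetI)
  fix e assume e: "e \<in> {e \<in> cyc R. e \<subseteq> B}"
  then obtain a b c where "e = {a, b, c}" "(a, b) \<in> R" "(b, c) \<in> R" "(c, a) \<in> R"
    by (metis (no_types, lifting) cycE mem_Collect_eq)
  then show "e \<in> cyc (R \<inter> B \<times> B)" using cycI[of a b "R \<inter> B \<times> B" c] e by simp
next
  fix e assume "e \<in> cyc (R \<inter> B \<times> B)"
  then obtain a b c where "e = {a, b, c}" "(a, b) \<in> R \<inter> B \<times> B" "(b, c) \<in> R \<inter> B \<times> B" "(c, a) \<in> R \<inter> B \<times> B"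
    by (rule cycE)
  then show "e \<in> {e \<in> cyc R. e \<subseteq> B}" using cycI[of a b R c] by simp
qed

lemma tour_restrict:
  assumes "tour V R" "B \<subseteq> V"
  shows "tour B (R \<inter> B \<times> B)"
proof (rule tourI)
  show "(y, x) \<notin> R \<inter> B \<times> B" if "(x, y) \<in> R \<inter> B \<times> B" for x y
    using that tour_asym[OF assms(1), of x y] by simp
  show "(x, y) \<in> R \<inter> B \<times> B \<or> (y, x) \<in> R \<inter> B \<times> B" if "x \<in> B" "y \<in> B" "x \<noteq> y" for x y
    using that assms(2) tour_total[OF assms(1), of x y] by blast
qed simp

lemma realizing_restrict:
  "R \<in> realizing V F \<Longrightarrow> B \<subseteq> V \<Longrightarrow> R \<inter> B \<times> B \<in> realizing B {e \<in> F. e \<subseteq> B}"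
  unfolding realizing_def using Collect_cyc_subset[of V R B] tour_restrict[of V R B] by auto

lemma glue_in:
  assumes "disjoint Q" "\<And>B. B \<in> Q \<Longrightarrow> g B \<subseteq> B \<times> B" "cross Q K = K" "B \<in> Q" "x \<in> B" "y \<in> B"
  shows "(x, y) \<in> glue Q K g \<longleftrightarrow> (x, y) \<in> g B"
proof
  assume "(x, y) \<in> glue Q K g"
  moreover have "(x, y) \<notin> K" using assms(3-6) cross_iff[of x y Q K] by blast
  ultimately obtain C where C: "C \<in> Q" "(x, y) \<in> g C" unfolding glue_def by blast
  then have "x \<in> C" using assms(2) by blast
  then have "C = B" using disjoint_eq[OF assms(1) C(1) assms(4)] assms(5) by blast
  then show "(x, y) \<in> g B" using C by blast
qed (use assms(4) in \<open>auto simp: glue_def\<close>)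

lemma glue_out:
  assumes "\<And>B. B \<in> Q \<Longrightarrow> g B \<subseteq> B \<times> B" "\<not> (\<exists>B\<in>Q. x \<in> B \<and> y \<in> B)"
  shows "(x, y) \<in> glue Q K g \<longleftrightarrow> (x, y) \<in> K"
  unfolding glue_def using assms by blast

lemma cross_cross: "cross Q (cross Q R) = cross Q R"
  unfolding cross_def by blast

lemma cross_glue:
  assumes "\<And>B. B \<in> Q \<Longrightarrow> g B \<subseteq> B \<times> B" "cross Q K = K"
  shows "cross Q (glue Q K g) = K"
proof (rule set_eqI)
  fix p show "p \<in> cross Q (glue Q K g) \<longleftrightarrow> p \<in> K"
  proof (cases p)
    case (Pair x y)
    have "(x, y) \<in> K \<longleftrightarrow> (x, y) \<in> K \<and> \<not> (\<exists>B\<in>Q. x \<in> B \<and> y \<in> B)"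
      using cross_iff[of x y Q K] unfolding assms(2) .
    moreover have "(x, y) \<in> glue Q K g \<longleftrightarrow> (x, y) \<in> K" if "\<not> (\<exists>B\<in>Q. x \<in> B \<and> y \<in> B)"
      by (rule glue_out[OF assms(1) that])
    ultimately show ?thesis unfolding Pair cross_iff by meson
  qed
qed

lemma glue_tour:
  assumes "disjoint Q" "\<Union>Q = V" and g: "\<And>B. B \<in> Q \<Longrightarrow> tour B (g B)" and K: "cross Q K = K" "K \<subseteq> V \<times> V"
    and asym: "\<And>x y. (x, y) \<in> K \<Longrightarrow> (y, x) \<notin> K"
    and total: "\<And>x y B C. B \<in> Q \<Longrightarrow> C \<in> Q \<Longrightarrow> B \<noteq> C \<Longrightarrow> x \<in> B \<Longrightarrow> y \<in> C \<Longrightarrow> (x, y) \<in> K \<or> (y, x) \<in> K"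
  shows "tour V (glue Q K g)"
proof -
  have gB: "g B \<subseteq> B \<times> B" if "B \<in> Q" for B using g[OF that] unfolding tour_def by blast
  note i = glue_in[OF assms(1) gB K(1)] and out = glue_out[OF gB, where Q = Q]
  show ?thesis
  proof (rule tourI)
    show "glue Q K g \<subseteq> V \<times> V" unfolding glue_def using gB K(2) assms(2) by blast
    show "(y, x) \<notin> glue Q K g" if xy: "(x, y) \<in> glue Q K g" for x y
    proof (cases "\<exists>B\<in>Q. x \<in> B \<and> y \<in> B")
      case True
      then obtain B where "B \<in> Q" "x \<in> B" "y \<in> B" by blast
      then show ?thesis using i[of B x y] i[of B y x] xy tour_asym[OF g] by blast
    next
      case False
      then have "\<not> (\<exists>B\<in>Q. y \<in> B \<and> x \<in> B)" by blast
      then show ?thesis using False out[of x y K] out[of y x K] xy asym by blast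
    qed
    show "(x, y) \<in> glue Q K g \<or> (y, x) \<in> glue Q K g" if xy: "x \<in> V" "y \<in> V" "x \<noteq> y" for x y
    proof -
      obtain B C where B: "B \<in> Q" "x \<in> B" and C: "C \<in> Q" "y \<in> C" using xy assms(2) by blast
      show ?thesis
      proof (cases "B = C")
        case True
        then show ?thesis using i[of B x y] i[of B y x] tour_total[OF g[OF B(1)], of x y] B C xy by blast
      next
        case False
        then show ?thesis using total[OF B(1) C(1) _ B(2) C(2)] unfolding glue_def by blast
      qed
    qed
  qed
qed

text \<open>For a member \<open>B\<close> of \<open>Q\<close> the module condition involves only
  arcs with exactly one end in \<open>B\<close>, and these cross.\<close>

lemma tour_module_cross_cong:
  assumes "disjoint Q" "cross Q R = cross Q R'" "B \<in> Q" "tour_module V R B"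
  shows "tour_module V R' B"
proof -
  have eq: "(v, x) \<in> R \<longleftrightarrow> (v, x) \<in> R'" if v: "v \<in> V - B" "x \<in> B" for v x
  proof -
    have "\<not> (\<exists>C\<in>Q. v \<in> C \<and> x \<in> C)" using disjoint_eq[OF assms(1,3)] v by blast
    then show ?thesis using assms(2) cross_iff[of v x Q R] cross_iff[of v x Q R'] by simp
  qed
  have "B \<subseteq> V" using assms(4) unfolding tour_module_def by (rule conjunct1)
  moreover have "(v, x) \<in> R' \<longleftrightarrow> (v, y) \<in> R'" if v: "v \<in> V - B" "x \<in> B" "y \<in> B" for v x y
  proof -
    have "(v, x) \<in> R \<longleftrightarrow> (v, y) \<in> R" using assms(4) that unfolding tour_module_def by blast
    then show ?thesis using eq[OF v(1,2)] eq[OF v(1,3)] by blast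
  qed
  ultimately show ?thesis unfolding tour_module_def by blast
qed

text \<open>An inclusion, so that it can be applied in both directions between a realization and its
  reglued version.\<close>

lemma cyc_cross_mono:
  assumes R: "tour V R" and mod: "\<And>B. B \<in> Q \<Longrightarrow> tour_module V R B" and sub: "cross Q R \<subseteq> R'"
    and inner: "\<And>B. B \<in> Q \<Longrightarrow> cyc (R \<inter> B \<times> B) \<subseteq> cyc R'"
  shows "cyc R \<subseteq> cyc R'"
proof
  fix e assume e: "e \<in> cyc R"
  then obtain a b c where abc: "e = {a, b, c}" and c: "(a, b) \<in> R" "(b, c) \<in> R" "(c, a) \<in> R" by (rule cycE)
  show "e \<in> cyc R'"
  proof (cases "\<exists>B\<in>Q. e \<subseteq> B")
    case True
    then obtain B where B: "B \<in> Q" "e \<subseteq> B" by blast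
    then have "e \<in> cyc (R \<inter> B \<times> B)" using Collect_cyc_subset[OF R, of B] e by blast
    then show ?thesis using inner[OF B(1)] by blast
  next
    case False
    have n: "\<not> (\<exists>B\<in>Q. p \<in> B \<and> q \<in> B)"
      if "(p, q) \<in> R" "(q, r) \<in> R" "(r, p) \<in> R" "{p, q, r} = e" for p q r
    proof
      assume "\<exists>B\<in>Q. p \<in> B \<and> q \<in> B"
      then obtain B where B: "B \<in> Q" "p \<in> B" "q \<in> B" by blast
      have "\<not> {p, q, r} \<subseteq> B" using False B(1) that(4) by blast
      then show False using tour_module_cycle(1)[OF R mod[OF B(1)] that(1-3) B(2)] B(3) by blast
    qed
    have "{b, c, a} = e" "{c, a, b} = e" unfolding abc by blast+
    then have "(a, b) \<in> cross Q R" "(b, c) \<in> cross Q R" "(c, a) \<in> cross Q R"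
      using c n[OF c(1,2,3)] n[OF c(2,3,1)] n[OF c(3,1,2)] abc unfolding cross_iff by simp_all
    then show ?thesis unfolding abc using sub by (intro cycI) blast+
  qed
qed

lemma glue_realizing:
  assumes Q: "disjoint Q" "\<Union>Q = V" and R: "R \<in> realizing V F" and mod: "\<And>B. B \<in> Q \<Longrightarrow> tour_module V R B"
    and g: "\<And>B. B \<in> Q \<Longrightarrow> g B \<in> realizing B {e \<in> F. e \<subseteq> B}"
  shows "glue Q (cross Q R) g \<in> realizing V F"
proof -
  let ?R = "glue Q (cross Q R) g"
  have Rt: "tour V R" and RF: "cyc R = F" using R unfolding realizing_def by auto
  have gt: "\<And>B. B \<in> Q \<Longrightarrow> tour B (g B)" and gc: "\<And>B. B \<in> Q \<Longrightarrow> cyc (g B) = {e \<in> F. e \<subseteq> B}"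
    using g unfolding realizing_def by auto
  have gB: "\<And>B. B \<in> Q \<Longrightarrow> g B \<subseteq> B \<times> B" using gt unfolding tour_def by blast
  have t: "tour V ?R"
  proof (rule glue_tour[OF Q gt cross_cross])
    show "cross Q R \<subseteq> V \<times> V" using Rt unfolding tour_def cross_def by blast
    show "(y, x) \<notin> cross Q R" if "(x, y) \<in> cross Q R" for x y
      using that tour_asym[OF Rt] unfolding cross_iff by blast
    fix x y B C assume B: "B \<in> Q" "C \<in> Q" "B \<noteq> C" "x \<in> B" "y \<in> C"
    have "\<not> (\<exists>D\<in>Q. x \<in> D \<and> y \<in> D)"
      using disjoint_eq[OF Q(1) B(1) _ B(4)] disjoint_eq[OF Q(1) B(2) _ B(5)] B(3) by blast
    moreover have "x \<noteq> y" using disjoint_eq[OF Q(1) B(1,2,4)] B(3,5) by blast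
    moreover have "x \<in> V" "y \<in> V" using Q(2) B by blast+
    ultimately show "(x, y) \<in> cross Q R \<or> (y, x) \<in> cross Q R"
      using tour_total[OF Rt, of x y] unfolding cross_iff by blast
  qed
  have cr: "cross Q ?R = cross Q R" by (rule cross_glue[OF gB cross_cross])
  have res: "?R \<inter> B \<times> B = g B" if "B \<in> Q" for B
  proof (rule set_eqI)
    fix p show "p \<in> ?R \<inter> B \<times> B \<longleftrightarrow> p \<in> g B"
      using glue_in[OF Q(1) gB cross_cross that, of "fst p" "snd p"] gB[OF that] by (cases p) auto
  qed
  have "cyc ?R \<subseteq> cyc R"
  proof (rule cyc_cross_mono[OF t])
    show "tour_module V ?R B" if "B \<in> Q" for B using tour_module_cross_cong[OF Q(1) cr[symmetric] that mod[OF that]] .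
    have "cross Q R \<subseteq> R" by (simp add: cross_def)
    then show "cross Q ?R \<subseteq> R" using cr by simp
    show "cyc (?R \<inter> B \<times> B) \<subseteq> cyc R" if "B \<in> Q" for B unfolding res[OF that] gc[OF that] RF by blast
  qed
  moreover have "cyc R \<subseteq> cyc ?R"
  proof (rule cyc_cross_mono[OF Rt mod])
    show "cross Q R \<subseteq> ?R" unfolding glue_def by blast
    show "cyc (R \<inter> B \<times> B) \<subseteq> cyc ?R" if "B \<in> Q" for B
    proof -
      have "cyc (R \<inter> B \<times> B) = cyc (?R \<inter> B \<times> B)"
        unfolding res[OF that] gc[OF that] Collect_cyc_subset[OF Rt, symmetric] RF ..
      then show ?thesis using Collect_cyc_subset[OF t, of B] by blast
    qed
  qed
  ultimately show ?thesis using t RF unfolding realizing_def by blast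
qed

text \<open>Taking crossing arcs and restrictions is inverted by \<open>glue\<close>; as the members
  of \<open>Q\<close> are modules of every realization, parts of different realizations may be
  combined. The first factor stays an image, to be evaluated separately for connected and
  disconnected hypergraphs.\<close>

lemma card_realizing_product:
  assumes Q: "disjoint Q" "\<Union>Q = V" "finite V"
    and mod: "\<And>R B. R \<in> realizing V F \<Longrightarrow> B \<in> Q \<Longrightarrow> tour_module V R B"
  shows "card (realizing V F) = card (cross Q ` realizing V F) * (\<Prod>B\<in>Q. card (realizing B {e \<in> F. e \<subseteq> B}))"
proof -
  let ?G = "\<Pi>\<^sub>E B\<in>Q. realizing B {e \<in> F. e \<subseteq> B}"
  have finQ: "finite Q" using Q(2,3) by (metis finite_UnionD)
  have BV: "B \<subseteq> V" if "B \<in> Q" for B using that Q(2) by blast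
  have gB: "g B \<subseteq> B \<times> B" if "g \<in> ?G" "B \<in> Q" for g B
    using PiE_mem[OF that] unfolding realizing_def tour_def by blast
  have "bij_betw (\<lambda>R. (cross Q R, \<lambda>B\<in>Q. R \<inter> B \<times> B)) (realizing V F) ((cross Q ` realizing V F) \<times> ?G)"
  proof (rule bij_betw_byWitness[where f' = "\<lambda>(K, g). glue Q K g"])
    show "\<forall>R\<in>realizing V F. (\<lambda>(K, g). glue Q K g) (cross Q R, \<lambda>B\<in>Q. R \<inter> B \<times> B) = R"
      unfolding glue_def cross_def by auto
    show "\<forall>p\<in>(cross Q ` realizing V F) \<times> ?G.
      (cross Q ((\<lambda>(K, g). glue Q K g) p), \<lambda>B\<in>Q. (\<lambda>(K, g). glue Q K g) p \<inter> B \<times> B) = p"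
    proof
      fix p assume "p \<in> (cross Q ` realizing V F) \<times> ?G"
      then obtain R g where p: "p = (cross Q R, g)" and g: "g \<in> ?G" by blast
      have "glue Q (cross Q R) g \<inter> B \<times> B = g B" if "B \<in> Q" for B
      proof (rule set_eqI)
        fix q show "q \<in> glue Q (cross Q R) g \<inter> B \<times> B \<longleftrightarrow> q \<in> g B"
          using glue_in[OF Q(1) gB[OF g] cross_cross that, of "fst q" "snd q"] gB[OF g that]
          by (cases q) auto
      qed
      then have "(\<lambda>B\<in>Q. glue Q (cross Q R) g \<inter> B \<times> B) = g"
        using PiE_restrict[OF g] by (metis (no_types, lifting) restrict_ext)
      moreover have "cross Q (glue Q (cross Q R) g) = cross Q R"
        by (rule cross_glue[OF gB[OF g] cross_cross])
      ultimately show "(cross Q ((\<lambda>(K, g). glue Q K g) p), \<lambda>B\<in>Q. (\<lambda>(K, g). glue Q K g) p \<inter> B \<times> B) = p"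
        unfolding p by simp
    qed
    show "(\<lambda>R. (cross Q R, \<lambda>B\<in>Q. R \<inter> B \<times> B)) ` realizing V F \<subseteq> (cross Q ` realizing V F) \<times> ?G"
      using realizing_restrict[OF _ BV] by auto
    show "(\<lambda>(K, g). glue Q K g) ` ((cross Q ` realizing V F) \<times> ?G) \<subseteq> realizing V F"
    proof
      fix R' assume "R' \<in> (\<lambda>(K, g). glue Q K g) ` ((cross Q ` realizing V F) \<times> ?G)"
      then obtain R g where R': "R' = glue Q (cross Q R) g" and R: "R \<in> realizing V F" and g: "g \<in> ?G" by auto
      show "R' \<in> realizing V F"
        unfolding R' by (rule glue_realizing[OF Q(1,2) R mod[OF R] PiE_mem[OF g]])
    qed
  qed
  then have "card (realizing V F) = card ((cross Q ` realizing V F) \<times> ?G)" by (rule bij_betw_same_card)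
  then show ?thesis by (simp add: card_cartesian_product card_PiE[OF finQ])
qed

section \<open>Transitive tournaments and components\<close>

lemma finite_realizing: "finite V \<Longrightarrow> finite (realizing V F)"
  by (rule finite_subset[of _ "Pow (V \<times> V)"]) (auto simp: realizing_def tour_def)

text \<open>A tournament without 3-cycles is transitive, hence acyclic, and a minimal vertex of a
  finite acyclic tournament dominates the rest.\<close>

lemma transitive_tour_source:
  assumes "finite Q" "Q \<noteq> {}" and J: "J \<in> realizing Q {}"
  obtains v where "v \<in> Q" "\<And>w. w \<in> Q \<Longrightarrow> w \<noteq> v \<Longrightarrow> (v, w) \<in> J"
proof -
  have t: "tour Q J" and c: "cyc J = {}" using J unfolding realizing_def by auto
  have "trans J"
  proof (rule transI)
    fix a b c assume ab: "(a, b) \<in> J" and bc: "(b, c) \<in> J"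
    have "(c, a) \<notin> J" using cycI[OF ab bc] \<open>cyc J = {}\<close> by blast
    moreover have "a \<noteq> c" using ab bc tour_asym[OF t] by blast
    ultimately show "(a, c) \<in> J" using tour_total[OF t, of c a] tour_field[OF t] ab bc by blast
  qed
  then have "acyclic J" using tour_irrefl[OF t] unfolding acyclic_def by (simp add: trancl_id)
  moreover have "finite J"
    using finite_subset[of J "Q \<times> Q"] assms(1) t unfolding tour_def by blast
  ultimately have "wf J" by (rule finite_acyclic_wf[rotated])
  moreover obtain q where "q \<in> Q" using assms(2) by blast
  ultimately obtain v where v: "v \<in> Q" "\<And>w. (w, v) \<in> J \<Longrightarrow> w \<notin> Q"
    by (metis wfE_min)
  then show ?thesis using that tour_total[OF t, of _ v] by metis
qed

lemma add_source_realizing: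
  assumes v: "v \<in> Q" and J: "J \<in> realizing (Q - {v}) {}"
  shows "J \<union> {v} \<times> (Q - {v}) \<in> realizing Q {}"
proof -
  have t: "tour (Q - {v}) J" and c: "cyc J = {}" using J unfolding realizing_def by auto
  let ?J = "J \<union> {v} \<times> (Q - {v})"
  have vJ: "(x, v) \<notin> J" "(v, x) \<notin> J" for x using tour_field[OF t] by blast+
  have JQ: "x \<in> Q \<and> y \<in> Q" if "(x, y) \<in> J" for x y using tour_field[OF t that] by blast
  have t': "tour Q ?J"
  proof (rule tourI)
    show "?J \<subseteq> Q \<times> Q" using JQ v by auto
    show "(y, x) \<notin> ?J" if "(x, y) \<in> ?J" for x y using that vJ tour_asym[OF t, of x y] by auto
    show "(x, y) \<in> ?J \<or> (y, x) \<in> ?J" if "x \<in> Q" "y \<in> Q" "x \<noteq> y" for x y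
      using that tour_total[OF t, of x y] by (cases "x = v"; cases "y = v") auto
  qed
  have "e \<notin> cyc ?J" for e
  proof
    assume "e \<in> cyc ?J"
    then obtain p q r where "(p, q) \<in> ?J" "(q, r) \<in> ?J" "(r, p) \<in> ?J" by (rule cycE)
    moreover have "(x, v) \<notin> ?J" for x using vJ by auto
    ultimately have "(p, q) \<in> J" "(q, r) \<in> J" "(r, p) \<in> J" by auto
    then show False using cycI[of p q J r] c by simp
  qed
  then have "cyc ?J = {}" by blast
  with t' show ?thesis by (simp add: realizing_def)
qed

text \<open>These tournaments are the strict linear orders of \<open>Q\<close>; the recursion
  removes the first element.\<close>

lemma card_transitive_tours: "finite Q \<Longrightarrow> card (realizing Q {}) = fact (card Q)"
proof (induction "card Q" arbitrary: Q)
  case 0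
  then have Q: "Q = {}" by simp
  have "realizing Q {} = {{}}"
    unfolding Q realizing_def tour_def irrefl_def cyc_def by auto
  then show ?case by (simp add: Q)
next
  case (Suc n)
  let ?f = "\<lambda>v J. J \<union> {v} \<times> (Q - {v})"
  have ne: "Q \<noteq> {}" using Suc.hyps(2) by auto
  have inner: "?f v J \<inter> (Q - {v}) \<times> (Q - {v}) = J" if "J \<in> realizing (Q - {v}) {}" for v J
    using that unfolding realizing_def tour_def by blast
  have "realizing Q {} = (\<Union>v\<in>Q. ?f v ` realizing (Q - {v}) {})"
  proof (intro equalityI subsetI)
    fix J assume J: "J \<in> realizing Q {}"
    have t: "tour Q J" using J unfolding realizing_def by blast
    obtain v where v: "v \<in> Q" "\<And>w. w \<in> Q \<Longrightarrow> w \<noteq> v \<Longrightarrow> (v, w) \<in> J"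
      using transitive_tour_source[OF Suc.prems ne J] by metis
    have "J \<inter> (Q - {v}) \<times> (Q - {v}) \<in> realizing (Q - {v}) {}"
      using realizing_restrict[OF J, of "Q - {v}"] by simp
    moreover have "?f v (J \<inter> (Q - {v}) \<times> (Q - {v})) = J"
    proof (intro equalityI subsetI)
      fix p assume "p \<in> ?f v (J \<inter> (Q - {v}) \<times> (Q - {v}))"
      then show "p \<in> J" using v(2) by auto
    next
      fix p assume p: "p \<in> J"
      obtain x y where xy: "p = (x, y)" by (cases p)
      have "x \<in> Q" "y \<in> Q" "x \<noteq> y" using p tour_field[OF t] tour_irrefl[OF t] unfolding xy by blast+
      moreover have "y \<noteq> v" using v(2)[of x] tour_asym[OF t, of x y] p \<open>x \<in> Q\<close> \<open>x \<noteq> y\<close> unfolding xy by blast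
      ultimately show "p \<in> ?f v (J \<inter> (Q - {v}) \<times> (Q - {v}))" using p unfolding xy by auto
    qed
    ultimately have "J \<in> ?f v ` realizing (Q - {v}) {}" by (intro image_eqI[OF sym])
    then show "J \<in> (\<Union>v\<in>Q. ?f v ` realizing (Q - {v}) {})" by (rule UN_I[OF v(1)])
  next
    fix J assume "J \<in> (\<Union>v\<in>Q. ?f v ` realizing (Q - {v}) {})"
    then obtain v where v: "v \<in> Q" and "J \<in> ?f v ` realizing (Q - {v}) {}" by (rule UN_E)
    then obtain J' where "J = ?f v J'" "J' \<in> realizing (Q - {v}) {}" by (elim imageE)
    then show "J \<in> realizing Q {}" using add_source_realizing[OF v] by metis
  qed
  also have "card \<dots> = (\<Sum>v\<in>Q. card (?f v ` realizing (Q - {v}) {}))"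
  proof (rule card_UN_disjoint[OF Suc.prems])
    show "\<forall>v\<in>Q. finite (?f v ` realizing (Q - {v}) {})"
      using finite_realizing[OF finite_Diff[OF Suc.prems]] by simp
    \<comment> \<open>Two different sources would dominate each other, so the sets of the union are
      disjoint.\<close>
    have "False" if v: "v \<in> Q" "w \<in> Q" "v \<noteq> w" and J: "J \<in> ?f v ` realizing (Q - {v}) {}" "J \<in> ?f w ` realizing (Q - {w}) {}"
      for v w J
    proof -
      have "J \<in> realizing Q {}" using add_source_realizing[OF v(1)] J(1) by auto
      then have "tour Q J" unfolding realizing_def by blast
      moreover have "(v, w) \<in> J" "(w, v) \<in> J" using J v by auto
      ultimately show False using tour_asym by metis
    qed
    then show "\<forall>v\<in>Q. \<forall>w\<in>Q. v \<noteq> w \<longrightarrow> ?f v ` realizing (Q - {v}) {} \<inter> ?f w ` realizing (Q - {w}) {} = {}"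
      by (metis (no_types, lifting) disjoint_iff)
  qed
  also have "\<dots> = (\<Sum>v\<in>Q. fact n)"
  proof (rule sum.cong[OF refl])
    fix v assume v: "v \<in> Q"
    have "inj_on (?f v) (realizing (Q - {v}) {})"
      by (rule inj_on_inverseI[where g = "\<lambda>J. J \<inter> (Q - {v}) \<times> (Q - {v})"]) (rule inner)
    then have "card (?f v ` realizing (Q - {v}) {}) = card (realizing (Q - {v}) {})" by (rule card_image)
    also have "\<dots> = fact n"
    proof -
      have "card (Q - {v}) = n" using v Suc.hyps(2) Suc.prems by simp
      then show ?thesis using Suc.hyps(1)[of "Q - {v}"] Suc.prems by simp
    qed
    finally show "card (?f v ` realizing (Q - {v}) {}) = fact n" .
  qed
  finally show ?case unfolding Suc.hyps(2)[symmetric] by (simp add: Suc.hyps(2)[symmetric])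
qed

text \<open>No edge contains both a vertex \<open>v\<close> outside \<open>C\<close> and a vertex of
  \<open>C\<close>. So if \<open>v\<close> dominates the tail of an arc inside \<open>C\<close>, it
  dominates the head as well, and along links this spreads over all of \<open>C\<close>.\<close>

lemma component_tour_module:
  assumes R: "tour (hverts H) R" and F: "hedges H = cyc R" and C: "C \<in> components H"
  shows "tour_module (hverts H) R C"
proof -
  have eV: "\<And>e. e \<in> hedges H \<Longrightarrow> e \<subseteq> hverts H" using cyc_sub[OF R] F by blast
  have CV: "C \<subseteq> hverts H" using Union_components[OF eV] C by blast
  have ne: "{v, x, y} \<notin> hedges H" if "v \<notin> C" "x \<in> C" for v x y
    using component_edge[OF C _ _ that(2), of "{v, x, y}"] that(1) by blast
  have push: "(v, y) \<in> R" if v: "v \<in> hverts H - C" and x: "x \<in> C" and vx: "(v, x) \<in> R" and l: "(x, y) \<in> link H" for v x y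
  proof -
    obtain e where e: "e \<in> hedges H" "x \<in> e" "y \<in> e" using l unfolding link_def by blast
    obtain b c where c: "e = {x, b, c}" "(x, b) \<in> R" "(b, c) \<in> R" "(c, x) \<in> R"
      using cyc_rotate[of e R x] e F by metis
    have eC: "b \<in> C" "c \<in> C" using component_edge[OF C e(1,2) x] c(1) by auto
    have no: "(q, v) \<notin> R" if "(v, p) \<in> R" "(p, q) \<in> R" "p \<in> C" for p q
      using cycI[of v p R q] ne[of v p q] that v F by blast
    have tot: "(v, q) \<in> R" if "(q, v) \<notin> R" "q \<in> C" for q
      using tour_total[OF R, of q v] that v CV by blast
    \<comment> \<open>The direction travels around the 3-cycle \<open>x\<close>, \<open>b\<close>,
      \<open>c\<close>, one of whose vertices is \<open>y\<close>.\<close>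
    have vb: "(v, b) \<in> R" using tot[OF no[OF vx c(2) x] eC(1)] .
    have "(v, c) \<in> R" using tot[OF no[OF vb c(3) eC(1)] eC(2)] .
    then show ?thesis using e(3) c(1) vb vx by auto
  qed
  have "(v, y) \<in> R" if v: "v \<in> hverts H - C" and x: "x \<in> C" and vx: "(v, x) \<in> R" and y: "(x, y) \<in> (link H)\<^sup>*" for v x y
  proof -
    have "(v, y) \<in> R \<and> y \<in> C" using y
    proof (induction rule: rtrancl_induct)
      case (step p q)
      then obtain e where "e \<in> hedges H" "p \<in> e" "q \<in> e" unfolding link_def by blast
      then have "q \<in> C" using component_edge[OF C, of e p] step by blast
      then show ?case using push[OF v _ _ step.hyps(2)] step.IH by blast
    qed (use vx x in blast)
    then show ?thesis by blast
  qed
  moreover have "(x, y) \<in> (link H)\<^sup>*" if "x \<in> C" "y \<in> C" for x y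
    using C that link_sym unfolding components_def
    by (metis (no_types, lifting) Image_singleton_iff imageE rtrancl_trans)
  ultimately show ?thesis unfolding tour_module_def using CV by metis
qed

section \<open>Disconnected hypergraphs and prime quotients\<close>

definition expand :: "'a set rel \<Rightarrow> 'a rel" where
  "expand J = (\<Union>(B, C)\<in>J. B \<times> C)"

lemma expand_iff:
  assumes "disjoint Q" "J \<subseteq> Q \<times> Q" "B \<in> Q" "C \<in> Q" "x \<in> B" "y \<in> C"
  shows "(x, y) \<in> expand J \<longleftrightarrow> (B, C) \<in> J"
proof
  assume "(x, y) \<in> expand J"
  then obtain B' C' where J: "(B', C') \<in> J" "x \<in> B'" "y \<in> C'" unfolding expand_def by blast
  then have "B' \<in> Q" "C' \<in> Q" using assms(2) by blast+
  then have "B' = B" "C' = C" using disjoint_eq[OF assms(1)] J assms(3-6) by blast+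
  with J show "(B, C) \<in> J" by blast
qed (use assms in \<open>auto simp: expand_def\<close>)

locale disconnected_realization =
  fixes H :: "'a hypergraph" and T :: "'a rel"
  assumes fin: "finite (hverts H)" and T: "tour (hverts H) T" and F: "hedges H = cyc T"
begin

abbreviation "V \<equiv> hverts H"
abbreviation "Q \<equiv> components H"

lemma edge_V: "e \<in> hedges H \<Longrightarrow> e \<subseteq> V"
  using cyc_sub[OF T] F by blast

lemma UQ: "\<Union>Q = V" by (rule Union_components[OF edge_V])

lemma nonempty: "B \<in> Q \<Longrightarrow> \<exists>x. x \<in> B"
  unfolding components_def by blast

lemma expand_subset:
  assumes "J \<subseteq> Q \<times> Q"
  shows "expand J \<subseteq> V \<times> V"
proof
  fix p assume "p \<in> expand J"
  then obtain B C where "(B, C) \<in> J" "p \<in> B \<times> C" unfolding expand_def by blast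
  then show "p \<in> V \<times> V" using assms UQ by blast
qed

lemma cross_expand:
  assumes J: "tour Q J"
  shows "cross Q (expand J) = expand J"
proof -
  have JQ: "J \<subseteq> Q \<times> Q" using J unfolding tour_def by blast
  have "(x, y) \<notin> expand J" if "B \<in> Q" "x \<in> B" "y \<in> B" for x y B
    using expand_iff[OF disjoint_components JQ that(1,1,2,3)] tour_irrefl[OF J] by blast
  then show ?thesis unfolding cross_def by blast
qed

text \<open>Arcs inside components are copied from \<open>T\<close>, the others are directed by
  \<open>J\<close>. Edges stay 3-cycles since each lies in one component, and a new 3-cycle would
  project to a closed walk in the linear order \<open>J\<close>.\<close>

lemma expand_realization:
  assumes J: "J \<in> realizing Q {}"
  shows "expand J \<in> cross Q ` realizing V (hedges H)"
proof -
  have Jt: "tour Q J" and Jc: "cyc J = {}" using J unfolding realizing_def by auto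
  have JQ: "J \<subseteq> Q \<times> Q" using Jt unfolding tour_def by blast
  note ex = expand_iff[OF disjoint_components JQ]
  define g where "g B = T \<inter> B \<times> B" for B
  define R where "R = glue Q (expand J) g"
  have gB: "g B \<subseteq> B \<times> B" for B unfolding g_def by blast
  have BV: "B \<subseteq> V" if "B \<in> Q" for B using that UQ by blast
  have Rt: "tour V R" unfolding R_def
  proof (rule glue_tour[OF disjoint_components UQ])
    show "tour B (g B)" if "B \<in> Q" for B unfolding g_def by (rule tour_restrict[OF T BV[OF that]])
    show "cross Q (expand J) = expand J" by (rule cross_expand[OF Jt])
    show "expand J \<subseteq> V \<times> V" by (rule expand_subset[OF JQ])
    show "(y, x) \<notin> expand J" if xy: "(x, y) \<in> expand J" for x y
    proof -
      obtain B C where BC: "(B, C) \<in> J" "x \<in> B" "y \<in> C" using xy unfolding expand_def by blast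
      then have "B \<in> Q" "C \<in> Q" using JQ by blast+
      then show ?thesis using ex[of C B y x] BC tour_asym[OF Jt BC(1)] by blast
    qed
    show "(x, y) \<in> expand J \<or> (y, x) \<in> expand J"
      if "B \<in> Q" "C \<in> Q" "B \<noteq> C" "x \<in> B" "y \<in> C" for x y B C
      using ex[of B C x y] ex[of C B y x] tour_total[OF Jt that(1,2,3)] that by blast
  qed
  have cr: "cross Q R = expand J" unfolding R_def by (rule cross_glue[OF gB cross_expand[OF Jt]])
  have same: "(x, y) \<in> R \<longleftrightarrow> (x, y) \<in> T" if "B \<in> Q" "x \<in> B" "y \<in> B" for B x y
    using glue_in[OF disjoint_components gB cross_expand[OF Jt] that] that unfolding R_def g_def by blast
  have diff: "(x, y) \<in> R \<longleftrightarrow> (B, C) \<in> J" if "B \<in> Q" "C \<in> Q" "B \<noteq> C" "x \<in> B" "y \<in> C" for B C x y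
  proof -
    have "\<not> (\<exists>D\<in>Q. x \<in> D \<and> y \<in> D)"
      using disjoint_eq[OF disjoint_components that(1) _ that(4)]
        disjoint_eq[OF disjoint_components that(2) _ that(5)] that(3) by blast
    then have "(x, y) \<in> R \<longleftrightarrow> (x, y) \<in> expand J" unfolding R_def by (rule glue_out[OF gB])
    then show ?thesis using ex[OF that(1,2,4,5)] by blast
  qed
  have "cyc T \<subseteq> cyc R"
  proof
    fix e assume e: "e \<in> cyc T"
    then obtain a b c where abc: "e = {a, b, c}" and c: "(a, b) \<in> T" "(b, c) \<in> T" "(c, a) \<in> T" by (rule cycE)
    have "a \<in> V" using tour_field[OF T c(1)] by blast
    then obtain B where B: "B \<in> Q" "a \<in> B" using UQ by blast
    have "e \<subseteq> B" using component_edge[OF B(1), of e a] e B(2) F abc by simp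
    then have "b \<in> B" "c \<in> B" using abc by blast+
    then show "e \<in> cyc R" unfolding abc using same[OF B(1)] B(2) c by (intro cycI) blast+
  qed
  moreover have "cyc R \<subseteq> cyc T"
  proof
    fix e assume e: "e \<in> cyc R"
    then obtain a b c where abc: "e = {a, b, c}" and c: "(a, b) \<in> R" "(b, c) \<in> R" "(c, a) \<in> R" by (rule cycE)
    have "a \<in> V" "b \<in> V" "c \<in> V" using tour_field[OF Rt] c by blast+
    then obtain A B C where A: "A \<in> Q" "a \<in> A" and B: "B \<in> Q" "b \<in> B" and C: "C \<in> Q" "c \<in> C"
      using UQ by blast
    have d: "(A, B) \<in> J" if "A \<noteq> B" using diff[OF A(1) B(1) that A(2) B(2)] c by blast
    have d': "(B, C) \<in> J" if "B \<noteq> C" using diff[OF B(1) C(1) that B(2) C(2)] c by blast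
    have d'': "(C, A) \<in> J" if "C \<noteq> A" using diff[OF C(1) A(1) that C(2) A(2)] c by blast
    \<comment> \<open>Otherwise the components visited would form a 2-cycle or a 3-cycle of
      \<open>J\<close>.\<close>
    have "A = B \<and> B = C"
    proof (rule ccontr)
      assume "\<not> (A = B \<and> B = C)"
      then consider "A = B" "B \<noteq> C" | "B = C" "A \<noteq> B" | "C = A" "A \<noteq> B" | "A \<noteq> B" "B \<noteq> C" "C \<noteq> A" by blast
      then show False
      proof cases
        case 1 then show False using d' d'' tour_asym[OF Jt] by blast
      next
        case 2 then show False using d d'' tour_asym[OF Jt] by blast
      next
        case 3 then show False using d d' tour_asym[OF Jt] by blast
      next
        case 4 then show False using cycI[OF d d' d''] Jc by blast
      qed
    qed
    then have "(a, b) \<in> T" "(b, c) \<in> T" "(c, a) \<in> T" using same[OF A(1)] A B C c by blast+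
    then show "e \<in> cyc T" unfolding abc by (rule cycI)
  qed
  ultimately have "R \<in> realizing V (hedges H)" using Rt F unfolding realizing_def by blast
  then show ?thesis using cr by (metis image_eqI)
qed

text \<open>Components are modules of \<open>R\<close>, so one arc between two of them fixes all the
  others. A 3-cycle among components would yield an edge with vertices in different
  components.\<close>

lemma cross_is_expand:
  assumes R: "R \<in> realizing V (hedges H)"
  shows "cross Q R \<in> expand ` realizing Q {}"
proof -
  have Rt: "tour V R" and RF: "hedges H = cyc R" using R unfolding realizing_def by auto
  define J where "J = {(B, C). B \<in> Q \<and> C \<in> Q \<and> B \<noteq> C \<and> (\<exists>x\<in>B. \<exists>y\<in>C. (x, y) \<in> R)}"
  have JQ: "J \<subseteq> Q \<times> Q" unfolding J_def by blast
  have uni: "(x', y') \<in> R"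
    if "B \<in> Q" "C \<in> Q" "B \<noteq> C" "x \<in> B" "y \<in> C" "x' \<in> B" "y' \<in> C" "(x, y) \<in> R" for B C x y x' y'
  proof -
    have V: "y \<in> V" "x' \<in> V" using that UQ by blast+
    have n: "y \<notin> B" "x' \<notin> C"
      using disjoint_eq[OF disjoint_components that(1,2)] that(3,5,6) by blast+
    have "(x', y) \<in> R"
      using tour_moduleD(2)[OF Rt component_tour_module[OF Rt RF that(1)] V(1) n(1) that(4,6)] that(8) by blast
    then show ?thesis
      using tour_moduleD(1)[OF Rt component_tour_module[OF Rt RF that(2)] V(2) n(2) that(5,7)] by blast
  qed
  have Jall: "(x, y) \<in> R" if "(B, C) \<in> J" "x \<in> B" "y \<in> C" for B C x y
    using that uni[of B C _ _ x y] unfolding J_def by blast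
  have Jt: "tour Q J"
  proof (rule tourI[OF JQ])
    show "(C, B) \<notin> J" if BC: "(B, C) \<in> J" for B C
    proof
      assume CB: "(C, B) \<in> J"
      obtain x y where "x \<in> B" "y \<in> C" using nonempty BC JQ by blast
      then have "(x, y) \<in> R" "(y, x) \<in> R" using Jall BC CB by blast+
      then show False using tour_asym[OF Rt] by blast
    qed
    show "(B, C) \<in> J \<or> (C, B) \<in> J" if BC: "B \<in> Q" "C \<in> Q" "B \<noteq> C" for B C
    proof -
      obtain x y where xy: "x \<in> B" "y \<in> C" using nonempty BC by blast
      have "x \<noteq> y" using disjoint_eq[OF disjoint_components BC(1,2)] xy BC(3) by blast
      moreover have "x \<in> V" "y \<in> V" using xy BC UQ by blast+
      ultimately have "(x, y) \<in> R \<or> (y, x) \<in> R" using tour_total[OF Rt] by blast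
      then show ?thesis using BC xy unfolding J_def by blast
    qed
  qed
  have "X \<notin> cyc J" for X
  proof
    assume "X \<in> cyc J"
    then obtain A B C where J3: "(A, B) \<in> J" "(B, C) \<in> J" "(C, A) \<in> J" by (rule cycE)
    then have ABQ: "A \<in> Q" "B \<in> Q" "C \<in> Q" "A \<noteq> B" unfolding J_def by blast+
    obtain a b c where abc: "a \<in> A" "b \<in> B" "c \<in> C" using nonempty ABQ(1-3) by metis
    have "{a, b, c} \<in> hedges H"
      unfolding RF using Jall[OF J3(1) abc(1,2)] Jall[OF J3(2) abc(2,3)] Jall[OF J3(3) abc(3,1)] by (rule cycI)
    then have "b \<in> A" using component_edge[OF ABQ(1) _ _ abc(1)] by blast
    then show False using disjoint_eq[OF disjoint_components ABQ(1,2) _ abc(2)] ABQ(4) by blast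
  qed
  then have "J \<in> realizing Q {}" using Jt unfolding realizing_def by blast
  moreover have "cross Q R = expand J"
  proof (rule set_eqI)
    fix p show "p \<in> cross Q R \<longleftrightarrow> p \<in> expand J"
    proof
      assume p: "p \<in> cross Q R"
      obtain x y where xy: "p = (x, y)" by (cases p)
      have R: "(x, y) \<in> R" and n: "\<not> (\<exists>B\<in>Q. x \<in> B \<and> y \<in> B)" using p unfolding xy cross_iff by blast+
      have "x \<in> V" "y \<in> V" using tour_field[OF Rt R] by blast+
      then obtain B C where B: "B \<in> Q" "x \<in> B" and C: "C \<in> Q" "y \<in> C" using UQ by blast
      then have "B \<noteq> C" using n by blast
      then have "(B, C) \<in> J" using B C R unfolding J_def by blast
      then show "p \<in> expand J" unfolding xy expand_def using B C by blast
    next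
      assume "p \<in> expand J"
      then obtain B C x y where J: "(B, C) \<in> J" "p = (x, y)" "x \<in> B" "y \<in> C" unfolding expand_def by blast
      have "p \<in> cross Q (expand J)" using \<open>p \<in> expand J\<close> cross_expand[OF Jt] by simp
      then show "p \<in> cross Q R" using Jall[OF J(1,3,4)] unfolding J(2) cross_iff by blast
    qed
  qed
  ultimately show ?thesis by blast
qed

lemma card_cross: "card (cross Q ` realizing V (hedges H)) = fact (card Q)"
proof -
  have "cross Q ` realizing V (hedges H) = expand ` realizing Q {}"
    using expand_realization cross_is_expand by blast
  moreover have "inj_on expand (realizing Q {})"
  proof (rule inj_onI)
    have sub: "J \<subseteq> J'" if J: "J \<in> realizing Q {}" "J' \<in> realizing Q {}" "expand J = expand J'" for J J'
    proof
      fix p assume p: "p \<in> J"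
      have JQ: "J \<subseteq> Q \<times> Q" "J' \<subseteq> Q \<times> Q" using J unfolding realizing_def tour_def by simp_all
      obtain B C where BC: "p = (B, C)" "B \<in> Q" "C \<in> Q" using p JQ by blast
      obtain x y where xy: "x \<in> B" "y \<in> C" using nonempty BC by blast
      have "(x, y) \<in> expand J'"
        using expand_iff[OF disjoint_components JQ(1) BC(2,3) xy] p J(3) unfolding BC(1) by blast
      then show "p \<in> J'" unfolding BC(1) using expand_iff[OF disjoint_components JQ(2) BC(2,3) xy] by blast
    qed
    fix J J' assume "J \<in> realizing Q {}" "J' \<in> realizing Q {}" "expand J = expand J'"
    then show "J = J'" using sub[of J J'] sub[of J' J] by simp
  qed
  moreover have "finite Q" using fin unfolding components_def by simp
  ultimately show ?thesis by (simp add: card_image card_transitive_tours)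
qed

end

text \<open>The union of a module of the quotient is a module of \<open>H\<close>, hence it is
  \<open>V\<close> or lies in one block. A triple inside no proper module becomes an edge of three
  blocks.\<close>

lemma (in connected_realization) blocks_quotient:
  "prime_hypergraph (quotient_hypergraph H blocks)" (is ?prime)
  "\<not> empty_hypergraph (quotient_hypergraph H blocks)" (is ?nonempty)
proof -
  let ?K = "quotient_hypergraph H blocks"
  define q where "q e = {X \<in> blocks. X \<inter> e \<noteq> {}}" for e
  have K: "hverts ?K = blocks" "hedges ?K = {E. E \<subseteq> blocks \<and> card E \<ge> 2 \<and> (\<exists>e\<in>hedges H. E = q e)}"
    unfolding quotient_hypergraph_def q_def by simp_all
  have fb: "finite blocks" using Union_blocks fin by (metis finite_UnionD)
  define bl where "bl x = (THE B. B \<in> blocks \<and> x \<in> B)" for x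
  have bl_eq: "bl x = B" if B: "B \<in> blocks" "x \<in> B" for x B
    unfolding bl_def
  proof (rule the_equality)
    show "C = B" if C: "C \<in> blocks \<and> x \<in> C" for C
      using disjoint_eq[OF disjoint_blocks _ B(1) _ B(2)] C by simp
  qed (simp add: B)
  have bl: "bl x \<in> blocks" "x \<in> bl x" if x: "x \<in> V" for x
  proof -
    obtain B where B: "B \<in> blocks" "x \<in> B" using x Union_blocks by blast
    show "bl x \<in> blocks" "x \<in> bl x" using bl_eq[OF B] B by simp_all
  qed
  have q_bl: "q e = bl ` e" if e: "e \<subseteq> V" for e
  proof (intro equalityI subsetI)
    fix X assume "X \<in> q e"
    then obtain x where "X \<in> blocks" "x \<in> X" "x \<in> e" unfolding q_def by blast
    then show "X \<in> bl ` e" using bl_eq by blast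
  next
    fix X assume "X \<in> bl ` e"
    then show "X \<in> q e" unfolding q_def using bl e by blast
  qed
  \<comment> \<open>An edge contained in no block meets each block at most once, so its image in the
    quotient again has three elements.\<close>
  have inj: "inj_on bl e" if e: "e \<in> hedges H" "\<And>B. B \<in> blocks \<Longrightarrow> \<not> e \<subseteq> B" for e
  proof (rule inj_onI)
    fix x y assume xy: "x \<in> e" "y \<in> e" "bl x = bl y"
    have V: "x \<in> V" "y \<in> V" using edge_V[OF e(1)] xy by blast+
    show "x = y"
      using edge_inter_block[OF bl(1)[OF V(1)] e(1) e(2)[OF bl(1)[OF V(1)]] xy(1,2)] bl(2)[OF V(1)] bl(2)[OF V(2)] xy(3)
      by simp
  qed
  have card3: "card e = 3" if "e \<in> hedges H" for e using cyc_card[OF T] that F by blast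
  obtain e where e: "e \<in> hedges H" and out: "\<And>M. tour_module V T M \<Longrightarrow> M \<noteq> V \<Longrightarrow> \<not> e \<subseteq> M"
    using crossing_triple by metis
  have nb: "\<not> e \<subseteq> B" if "B \<in> blocks" for B using out blocksD(1,2)[OF that] by blast
  have qe: "card (q e) = 3" unfolding q_bl[OF edge_V[OF e]] using card_image[OF inj[OF e nb]] card3[OF e] by simp
  have qsub: "q e \<subseteq> blocks" unfolding q_def by blast
  have "q e \<in> hedges ?K" unfolding K using qe qsub e by auto
  then show ?nonempty unfolding empty_hypergraph_def by blast
  have three: "card blocks \<ge> 3" using card_mono[OF fb qsub] qe by simp
  have "trivial_hmodule ?K M" if M: "hmodule ?K M" for M
  proof (cases "M = {}")
    case False
    have Mb: "M \<subseteq> blocks" using hmodule_subset[OF M] K by simp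
    have mem: "x \<in> \<Union>M \<longleftrightarrow> bl x \<in> M" if "x \<in> V" for x
      using bl[OF that] bl_eq Mb by blast
    have UM: "hmodule H (\<Union>M)"
    proof (rule hmoduleI)
      show "\<Union>M \<subseteq> V" using Mb Union_blocks by blast
      fix f assume f: "f \<in> hedges H" "f \<inter> \<Union>M \<noteq> {}" "\<not> f \<subseteq> \<Union>M"
      have fV: "f \<subseteq> V" by (rule edge_V[OF f(1)])
      show "\<exists>m\<in>\<Union>M. f \<inter> \<Union>M = {m} \<and> (\<forall>n\<in>\<Union>M. insert n (f - {m}) \<in> hedges H)"
      proof -
        have fb: "\<not> f \<subseteq> B" if B: "B \<in> blocks" for B
        proof
          assume fB: "f \<subseteq> B"
          obtain x y where "x \<in> f" "bl x \<in> M" "y \<in> f" "bl y \<notin> M" using f(2,3) mem fV by blast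
          then show False using fB bl_eq[OF B] by (metis subsetD)
        qed
        have if': "inj_on bl f" by (rule inj[OF f(1) fb])
        have qf: "q f = bl ` f" by (rule q_bl[OF fV])
        have cq: "card (q f) = 3" unfolding qf using card_image[OF if'] card3[OF f(1)] by simp
        have "q f \<subseteq> blocks" unfolding q_def by blast
        then have Ef: "q f \<in> hedges ?K" unfolding K using cq f(1) by auto
        have "q f \<inter> M \<noteq> {}" "\<not> q f \<subseteq> M" unfolding qf using f(2,3) mem fV by blast+
        then obtain X where X: "X \<in> M" "q f \<inter> M = {X}" "\<And>Y. Y \<in> M \<Longrightarrow> insert Y (q f - {X}) \<in> hedges ?K"
          using hmoduleE[OF M Ef] by metis
        have "X \<in> bl ` f" using X(2) qf by blast
        then obtain m where m: "m \<in> f" "bl m = X" by blast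
        have mM: "m \<in> \<Union>M" using mem[of m] m X(1) fV by blast
        have only: "x = m" if x: "x \<in> f" "x \<in> \<Union>M" for x
        proof -
          have "bl x \<in> q f \<inter> M" using x mem[of x] fV qf by blast
          then have "bl x = bl m" using X(2) m(2) by simp
          then show ?thesis using inj_onD[OF if'] x(1) m(1) by blast
        qed
        have ext: "insert n (f - {m}) \<in> hedges H" if n: "n \<in> \<Union>M" for n
        proof -
          have nV: "n \<in> V" using n Mb Union_blocks by blast
          have blM: "bl n \<in> M" using mem[OF nV] n by blast
          \<comment> \<open>The quotient only yields some edge \<open>f'\<close> meeting the blocks
            of \<open>n\<close>, \<open>u\<close> and \<open>w\<close>; its vertices are then
            exchanged for these three, one block at a time.\<close>
          obtain f' where f': "f' \<in> hedges H" "insert (bl n) (q f - {X}) = q f'"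
            using X(3)[OF blM] unfolding K by blast
          have f'V: "f' \<subseteq> V" by (rule edge_V[OF f'(1)])
          have "card f = 3" by (rule card3[OF f(1)])
          then have "card (f - {m}) = 2" using m(1) by (simp add: card_Diff_singleton_if)
          then obtain u w where uw: "f - {m} = {u, w}" "u \<noteq> w" unfolding card_2_iff by blast
          have uwf: "u \<in> f" "w \<in> f" "u \<noteq> m" "w \<noteq> m" using uw by blast+
          have "bl ` (f - {m}) = bl ` f - {X}"
            using inj_on_image_set_diff[OF if', of f "{m}"] m by simp
          then have qX: "q f - {X} = {bl u, bl w}" unfolding qf using uw(1) by simp
          have nuw: "bl u \<notin> M" "bl w \<notin> M" using only uwf mem fV by blast+
          have "bl u \<noteq> bl w" using inj_onD[OF if' _ uwf(1,2)] uw(2) by blast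
          have imf: "bl ` f' = {bl n, bl u, bl w}" using f'(2) qX q_bl[OF f'V] by simp
          obtain n' where n': "n' \<in> f'" "bl n' = bl n" using imf by (metis imageE insertI1)
          obtain u' where u': "u' \<in> f'" "bl u' = bl u" using imf by (metis imageE insertI1 insertI2)
          obtain w' where w': "w' \<in> f'" "bl w' = bl w" using imf by (metis imageE insertI1 insertI2)
          have ne: "n' \<noteq> u'" "n' \<noteq> w'" "u' \<noteq> w'"
            using n' u' w' blM nuw \<open>bl u \<noteq> bl w\<close> by metis+
          have "f' = {n', u', w'}"
          proof (rule card_subset_eq[symmetric])
            show "finite f'" using finite_subset[OF f'V fin] .
            show "card {n', u', w'} = card f'" using ne card3[OF f'(1)] by simp
          qed (use n' u' w' in blast)
          then have f3: "{n', u', w'} \<in> hedges H" using f'(1) by simp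
          \<comment> \<open>The block of \<open>x\<close> is a module of \<open>H\<close>, and
            \<open>p\<close> lies outside it. So the edge meets it in \<open>x\<close> alone, and
            \<open>x\<close> may be exchanged within its block.\<close>
          have rep: "{y, p, r} \<in> hedges H"
            if g: "{x, p, r} \<in> hedges H" and b: "bl x = bl y" "bl p \<noteq> bl x" and V: "x \<in> V" "y \<in> V" "p \<in> V" for x y p r
          proof -
            have hb: "hmodule H (bl x)" using block_strong[OF bl(1)[OF V(1)]] unfolding strong_hmodule_def by blast
            have px: "p \<notin> bl x" using bl_eq[OF bl(1)[OF V(1)], of p] b(2) by blast
            then have "\<not> {x, p, r} \<subseteq> bl x" "{x, p, r} \<inter> bl x \<noteq> {}" using bl(2)[OF V(1)] by blast+
            then obtain z where z: "{x, p, r} \<inter> bl x = {z}"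
              "\<And>y. y \<in> bl x \<Longrightarrow> insert y ({x, p, r} - {z}) \<in> hedges H"
              using hmoduleE[OF hb g] by metis
            have "x \<in> {x, p, r} \<inter> bl x" using bl(2)[OF V(1)] by blast
            then have "z = x" unfolding z(1) by simp
            have "card {x, p, r} = 3" by (rule card3[OF g])
            then have "x \<noteq> p" "x \<noteq> r" by (auto simp: card_insert_if split: if_splits)
            then have "{x, p, r} - {z} = {p, r}" unfolding \<open>z = x\<close> by blast
            moreover have "y \<in> bl x" using bl(2)[OF V(2)] b(1) by simp
            ultimately show ?thesis using z(2)[of y] by simp
          qed
          have V: "n' \<in> V" "u' \<in> V" "w' \<in> V" "u \<in> V" "w \<in> V" using n' u' w' f'V uwf fV by blast+
          have "{n, u', w'} \<in> hedges H"
            by (rule rep[OF f3 n'(2) _ V(1) nV V(2)]) (use n' u' blM nuw in metis)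
          then have "{u', n, w'} \<in> hedges H" by (simp add: insert_commute)
          then have "{u, n, w'} \<in> hedges H"
            by (rule rep[OF _ u'(2) _ V(2,4) nV]) (use u' blM nuw in metis)
          then have "{w', n, u} \<in> hedges H" by (simp add: insert_commute)
          then have "{w, n, u} \<in> hedges H"
            by (rule rep[OF _ w'(2) _ V(3,5) nV]) (use w' blM nuw in metis)
          then show ?thesis unfolding uw(1) by (simp add: insert_commute)
        qed
        have "f \<inter> \<Union>M = {m}" using only m(1) mM by blast
        then show ?thesis using mM ext by blast
      qed
    qed
    show ?thesis
    proof (cases "\<Union>M = V")
      case True
      have "B \<in> M" if B: "B \<in> blocks" for B
      proof -
        obtain x where x: "x \<in> B" using blocksD(3)[OF B] by blast
        then have "x \<in> V" using blocksD(5)[OF B] by blast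
        then show ?thesis using mem[of x] bl_eq[OF B x] True by simp
      qed
      then have "M = blocks" using Mb by blast
      then show ?thesis unfolding trivial_hmodule_def K by blast
    next
      case False
      obtain B where B: "B \<in> M" using \<open>M \<noteq> {}\<close> by blast
      then have "\<Union>M \<noteq> {}" using blocksD(3) Mb by blast
      then obtain C where C: "C \<in> blocks" "\<Union>M \<subseteq> C" using hmodule_in_block[OF UM False] by metis
      have "D = C" if D: "D \<in> M" for D
      proof -
        have Db: "D \<in> blocks" using D Mb by blast
        obtain x where x: "x \<in> D" using blocksD(3)[OF Db] by blast
        then have "x \<in> C" using C(2) D by blast
        then show ?thesis using disjoint_eq[OF disjoint_blocks Db C(1) x] by blast
      qed
      then have "M = {C}" using B by blast
      then show ?thesis unfolding trivial_hmodule_def K using C by blast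
    qed
  qed (simp add: trivial_hmodule_def)
  then show ?prime unfolding prime_hypergraph_def K(1) using three by blast
qed

section \<open>Counting realizations\<close>

lemma tour_module_converse:
  assumes T: "tour V T" and M: "tour_module V T M"
  shows "tour_module V (T\<inverse>) M"
  unfolding tour_module_def
proof (intro conjI ballI)
  show "M \<subseteq> V" using M unfolding tour_module_def by simp
  fix v x y assume "v \<in> V - M" "x \<in> M" "y \<in> M"
  then show "(v, x) \<in> T\<inverse> \<longleftrightarrow> (v, y) \<in> T\<inverse>" using tour_moduleD(2)[OF T M, of v x y] by simp
qed

text \<open>Being a module depends on the crossing arcs only, and those of \<open>R\<close> are the
  arcs of \<open>T\<close> or of its converse.\<close>

lemma (in connected_realization) block_tour_module:
  assumes R: "R \<in> realizing V (hedges H)" and B: "B \<in> blocks"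
  shows "tour_module V R B"
proof -
  have Rt: "tour V R" and eq: "cyc R = cyc T" using R F unfolding realizing_def by auto
  note TB = blocksD(1)[OF B]
  from realization_cross[OF Rt eq] show ?thesis
  proof
    assume "cross blocks R = cross blocks T"
    then show ?thesis using tour_module_cross_cong[OF disjoint_blocks _ B TB] by metis
  next
    assume "cross blocks R = (cross blocks T)\<inverse>"
    then have "cross blocks (T\<inverse>) = cross blocks R" by (simp add: cross_converse)
    then show ?thesis using tour_module_cross_cong[OF disjoint_blocks _ B tour_module_converse[OF T TB]] by metis
  qed
qed

text \<open>The contribution of one node of the decomposition. Two conditional factors with default
  1 let the product over all strong modules split into the power of 2 and the product of
  factorials.\<close>

definition weight :: "'a hypergraph \<Rightarrow> nat" where
  "weight K =
     (if prime_hypergraph (quotient_hypergraph K (max_strong_hmodules K)) then 2 else 1) *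
     (if empty_hypergraph (quotient_hypergraph K (max_strong_hmodules K))
      then fact (card (max_strong_hmodules K)) else 1)"

lemma prod_weight_step:
  assumes fin: "finite (hverts H)" and two: "card (hverts H) \<ge> 2"
    and F: "\<And>e. e \<in> hedges H \<Longrightarrow> e \<subseteq> hverts H" and Q: "strong_partition H Q"
  shows "(\<Prod>X\<in>strong_hmodules_ge2 H. weight (induced_hypergraph H X)) =
    weight H * (\<Prod>B\<in>Q. \<Prod>X\<in>strong_hmodules_ge2 (induced_hypergraph H B).
      weight (induced_hypergraph (induced_hypergraph H B) X))"
proof -
  let ?S = "\<lambda>B. strong_hmodules_ge2 (induced_hypergraph H B)"
  have SB: "X \<subseteq> B" "X \<noteq> {}" if "X \<in> ?S B" for X B
  proof -
    have "hmodule (induced_hypergraph H B) X" "card X \<ge> 2"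
      using that unfolding strong_hmodules_ge2_def strong_hmodule_def by auto
    then show "X \<subseteq> B" "X \<noteq> {}"
      using hmodule_subset[of "induced_hypergraph H B" X] by (auto simp: induced_hypergraph_def)
  qed
  have BV: "B \<subseteq> hverts H" "B \<noteq> hverts H" if "B \<in> Q" for B
    using strong_partition_Union[OF Q] strong_partition_proper[OF Q that] that by blast+
  have finB: "finite B" if "B \<in> Q" for B using finite_subset[OF BV(1)[OF that] fin] .
  have finS: "finite (?S B)" if "B \<in> Q" for B
    by (rule finite_subset[of _ "Pow B"]) (use SB(1) finB[OF that] in auto)
  have finQ: "finite Q" using strong_partition_Union[OF Q] fin by (metis finite_UnionD)
  have nV: "hverts H \<notin> (\<Union>B\<in>Q. ?S B)" using SB(1) BV by blast
  have HV: "induced_hypergraph H (hverts H) = H"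
    using F unfolding induced_hypergraph_def by (cases H) auto
  have rec: "strong_hmodules_ge2 H = insert (hverts H) (\<Union>B\<in>Q. ?S B)"
    by (rule strong_hmodules_ge2_rec[OF Q _ two]) (rule F)
  have dis: "?S B \<inter> ?S C = {}" if BC: "B \<in> Q" "C \<in> Q" "B \<noteq> C" for B C
  proof (rule ccontr)
    assume "?S B \<inter> ?S C \<noteq> {}"
    then obtain X where X: "X \<in> ?S B" "X \<in> ?S C" by blast
    obtain x where "x \<in> X" using SB(2)[OF X(1)] by blast
    then have "x \<in> B" "x \<in> C" using SB(1)[OF X(1)] SB(1)[OF X(2)] by blast+
    then show False using disjoint_eq[OF strong_partition_disjoint[OF Q] BC(1,2)] BC(3) by blast
  qed
  have "(\<Prod>X\<in>strong_hmodules_ge2 H. weight (induced_hypergraph H X)) =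
      weight H * (\<Prod>X\<in>(\<Union>B\<in>Q. ?S B). weight (induced_hypergraph H X))"
    unfolding rec using nV finQ finS by (simp add: HV)
  also have "(\<Prod>X\<in>(\<Union>B\<in>Q. ?S B). weight (induced_hypergraph H X)) =
      (\<Prod>B\<in>Q. \<Prod>X\<in>?S B. weight (induced_hypergraph H X))"
    by (rule prod.UNION_disjoint[OF finQ]) (use finS dis in auto)
  also have "\<dots> = (\<Prod>B\<in>Q. \<Prod>X\<in>?S B. weight (induced_hypergraph (induced_hypergraph H B) X))"
    by (intro prod.cong refl) (simp add: induced_induced[OF SB(1)])
  finally show ?thesis .
qed

lemma card_realizing_small:
  assumes fin: "finite V" and small: "card V < 2" and T: "T \<in> realizing V F"
  shows "card (realizing V F) = 1"
proof -
  have one: "x = y" if "x \<in> V" "y \<in> V" for x y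
    using small fin that card_le_Suc0_iff_eq[OF fin] by simp
  have "R = {}" if R: "R \<in> realizing V F" for R
  proof -
    have t: "tour V R" using R unfolding realizing_def by blast
    have "(x, y) \<notin> R" for x y using one[of x y] tour_field[OF t, of x y] tour_irrefl[OF t, of x] by auto
    then show ?thesis by auto
  qed
  then have "realizing V F = {T}" using T by blast
  then show ?thesis by simp
qed

text \<open>The common interface of the two cases: a connected \<open>H\<close> has a prime quotient
  and weight 2, a disconnected one an empty quotient and a factorial weight.\<close>

lemma realization_partition:
  assumes fin: "finite (hverts H)" and T: "tour (hverts H) T" and F: "hedges H = cyc T"
    and two: "card (hverts H) \<ge> 2"
  obtains Q where "strong_partition H Q"
    "\<And>R B. R \<in> realizing (hverts H) (hedges H) \<Longrightarrow> B \<in> Q \<Longrightarrow> tour_module (hverts H) R B"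
    "card (cross Q ` realizing (hverts H) (hedges H)) = weight H"
proof (cases "hverts H \<in> components H")
  case True
  interpret connected_realization H T by unfold_locales (fact fin T F True two)+
  have "max_strong_hmodules H = blocks"
    by (rule max_strong_hmodules_eq[OF strong_partition_blocks]) (use two in auto)
  then have "weight H = 2" unfolding weight_def using blocks_quotient by simp
  then show ?thesis using that[OF strong_partition_blocks block_tour_module] card_cross by simp
next
  case False
  interpret disconnected_realization H T by unfold_locales (fact fin T F)+
  have sp: "strong_partition H (components H)" by (rule strong_partition_components[OF edge_V False])
  have "max_strong_hmodules H = components H"
    by (rule max_strong_hmodules_eq[OF sp]) (use two in auto)
  then have "weight H = fact (card (components H))"
    unfolding weight_def using quotient_components_empty[of H] empty_not_prime by simp
  moreover have "tour_module (hverts H) R B" if "R \<in> realizing (hverts H) (hedges H)" "B \<in> components H" for R B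
    using component_tour_module[of H R B] that unfolding realizing_def by simp
  ultimately show ?thesis using that[OF sp] card_cross by simp
qed

lemma card_realizing_weight:
  assumes "finite (hverts H)" "T \<in> realizing (hverts H) (hedges H)"
  shows "card (realizing (hverts H) (hedges H)) =
    (\<Prod>X\<in>strong_hmodules_ge2 H. weight (induced_hypergraph H X))"
  using assms
proof (induction "card (hverts H)" arbitrary: H T rule: less_induct)
  case less
  note fin = less.prems(1)
  have T: "tour (hverts H) T" and F: "hedges H = cyc T" using less.prems(2) unfolding realizing_def by auto
  have eV: "\<And>e. e \<in> hedges H \<Longrightarrow> e \<subseteq> hverts H" using cyc_sub[OF T] F by blast
  show ?case
  proof (cases "card (hverts H) < 2")
    case True
    have "X \<notin> strong_hmodules_ge2 H" for X
    proof
      assume "X \<in> strong_hmodules_ge2 H"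
      then have "hmodule H X" "card X \<ge> 2" unfolding strong_hmodules_ge2_def strong_hmodule_def by auto
      then show False using card_mono[OF fin hmodule_subset] True by fastforce
    qed
    then have "strong_hmodules_ge2 H = {}" by blast
    then show ?thesis using card_realizing_small[OF fin True less.prems(2)] by simp
  next
    case False
    then have two: "card (hverts H) \<ge> 2" by simp
    obtain Q where Q: "strong_partition H Q"
      and mod: "\<And>R B. R \<in> realizing (hverts H) (hedges H) \<Longrightarrow> B \<in> Q \<Longrightarrow> tour_module (hverts H) R B"
      and w: "card (cross Q ` realizing (hverts H) (hedges H)) = weight H"
      using realization_partition[OF fin T F two] by metis
    have IH: "card (realizing B {e \<in> hedges H. e \<subseteq> B}) =
        (\<Prod>X\<in>strong_hmodules_ge2 (induced_hypergraph H B).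
          weight (induced_hypergraph (induced_hypergraph H B) X))" if B: "B \<in> Q" for B
    proof -
      have BV: "B \<subset> hverts H" using strong_partition_Union[OF Q] strong_partition_proper[OF Q B] B by blast
      have iB: "hverts (induced_hypergraph H B) = B" "hedges (induced_hypergraph H B) = {e \<in> hedges H. e \<subseteq> B}"
        by (simp_all add: induced_hypergraph_def)
      \<comment> \<open>The restriction of \<open>T\<close> witnesses that the hypergraph induced on
        \<open>B\<close> is realizable again, as the induction hypothesis requires.\<close>
      have "T \<inter> B \<times> B \<in> realizing B {e \<in> hedges H. e \<subseteq> B}"
        by (rule realizing_restrict[OF less.prems(2)]) (use BV in blast)
      then show ?thesis
        using less.hyps[of "induced_hypergraph H B" "T \<inter> B \<times> B"] psubset_card_mono[OF fin BV]
          finite_subset[OF _ fin, of B] BV unfolding iB by blast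
    qed
    have "card (realizing (hverts H) (hedges H)) =
        weight H * (\<Prod>B\<in>Q. card (realizing B {e \<in> hedges H. e \<subseteq> B}))"
      using card_realizing_product[OF strong_partition_disjoint[OF Q] strong_partition_Union[OF Q] fin mod] w by simp
    also have "\<dots> = weight H * (\<Prod>B\<in>Q. \<Prod>X\<in>strong_hmodules_ge2 (induced_hypergraph H B).
        weight (induced_hypergraph (induced_hypergraph H B) X))"
      using IH by simp
    also have "\<dots> = (\<Prod>X\<in>strong_hmodules_ge2 H. weight (induced_hypergraph H X))"
      by (rule prod_weight_step[OF fin two eV Q, symmetric])
    finally show ?thesis .
  qed
qed

theorem corollary57:
  fixes H :: "'a hypergraph"
  assumes "three_uniform H" and "realizable H"
  shows "card (realizations H) =
    2 ^ card (strong_hmodules_prime H) *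
    (\<Prod>X \<in> strong_hmodules_empty H.
       fact (card (max_strong_hmodules (induced_hypergraph H X))))"
proof -
  have fin: "finite (hverts H)" using assms(1) unfolding three_uniform_def by blast
  obtain S where S: "tournament S" "pverts S = hverts H" "H = C3_structure S"
    using assms(2) unfolding realizable_def realizations_def by blast
  have "parcs S \<in> realizing (hverts H) (hedges H)"
    using S(1,2) arg_cong[OF S(3), of hedges] C3_structure_eq[OF S(1)]
    unfolding realizing_def tournament_iff by simp
  note card = card_realizing_weight[OF fin this]
  let ?S = "strong_hmodules_ge2 H"
  let ?q = "\<lambda>X. quotient_hypergraph (induced_hypergraph H X) (max_strong_hmodules (induced_hypergraph H X))"
  let ?f = "\<lambda>X. fact (card (max_strong_hmodules (induced_hypergraph H X))) :: nat"
  have finS: "finite ?S"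
  proof (rule finite_subset[of _ "Pow (hverts H)"])
    show "?S \<subseteq> Pow (hverts H)"
      using hmodule_subset unfolding strong_hmodules_ge2_def strong_hmodule_def by blast
  qed (simp add: fin)
  have "(\<Prod>X\<in>?S. weight (induced_hypergraph H X)) =
      (\<Prod>X\<in>?S. if prime_hypergraph (?q X) then 2 else 1) *
      (\<Prod>X\<in>?S. if empty_hypergraph (?q X) then ?f X else 1)"
    unfolding weight_def by (rule prod.distrib)
  also have "(\<Prod>X\<in>?S. if prime_hypergraph (?q X) then 2 else 1) = (2 :: nat) ^ card (strong_hmodules_prime H)"
    unfolding strong_hmodules_prime_def using prod.inter_filter[OF finS, of "\<lambda>_. 2 :: nat"] by simp
  also have "(\<Prod>X\<in>?S. if empty_hypergraph (?q X) then ?f X else 1) = (\<Prod>X\<in>strong_hmodules_empty H. ?f X)"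
    unfolding strong_hmodules_empty_def using prod.inter_filter[OF finS, of ?f] by simp
  finally show ?thesis using card card_realizations[OF fin] by simp
qed

end
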